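(* Let $\delta>0$. Then there exists $c_\delta>0$ such that $$\inf\left\{ \frac{\mathcal{E}(\gamma)}{\mathcal{L}(\gamma)} : \gamma\in C^\infty(\mathbb{S}^1,\mathbb{H}^2),\ \gamma \text{ immersed},\ \mathcal{E}(\gamma)\le 16-\delta\right\}\ \ge\ c_\delta .$$ Moreover, $$\inf\left\{ \frac{\mathcal{E}(\gamma)}{\mathcal{L}(\gamma)} : \gamma\in C^\infty(\mathbb{S}^1,\mathbb{H}^2),\ \gamma \text{ immersed},\ \mathcal{E}(\gamma)\le 16+\delta\right\}\ =\ 0 .$$
   Context: $\mathbb{H}^2=\mathbb{R}\times(0,\infty)$ is the hyperbolic half plane with metric $g_{(x,y)}=\frac{1}{y^2}(dx^2+dy^2)$ and Levi-Civita connection $\nabla$. For an immersed curve $\gamma=(\gamma_1,\gamma_2)$ in $\mathbb{H}^2$, $ds=\frac{\sqrt{\gamma_1'^2+\gamma_2'^2}}{\gamma_2}\,dt$ is the hyperbolic arclength element, $\mathcal{L}(\gamma)=\int_\gamma ds$ is the hyperbolic length, $T$ is the (hyperbolic) unit tangent field, $N=iT$ is the unit normal obtained by rotating $T$ by $+\pi/2$ (in $\mathbb{H}^2\subset\mathbb{C}$), the scalar curvature $\kappa$ is defined by $\nabla_TT=\kappa N$, and the elastic energy is $\mathcal{E}(\gamma)=\int_\gamma\kappa^2\,ds$. The infimum of the empty set is $+\infty$. *)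

theory Defs
  imports "HOL-Analysis.Analysis"
begin

text \<open>The half plane is modelled inside the type of complex numbers, and every tangent space is
  identified with the complex numbers.\<close>

definition half_plane :: "complex set" where
  "half_plane = {z. Im z > 0}"

definition hyp_metric :: "complex \<Rightarrow> complex \<Rightarrow> complex \<Rightarrow> real" where
  "hyp_metric p u v = (u \<bullet> v) / (Im p)\<^sup>2"

definition hyp_norm :: "complex \<Rightarrow> complex \<Rightarrow> real" where
  "hyp_norm p v = sqrt (hyp_metric p v v)"

text \<open>The Levi-Civita connection on constant vector fields \<open>u\<close>, \<open>v\<close>, characterised by Koszul's
  formula (all Lie brackets vanish); equivalently, the bilinear map whose components are the
  Christoffel symbols.\<close>

definition hyp_christoffel :: "complex \<Rightarrow> complex \<Rightarrow> complex \<Rightarrow> complex" where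
  "hyp_christoffel p u v = (THE z. \<forall>w. 2 * hyp_metric p z w =
      frechet_derivative (\<lambda>q. hyp_metric q v w) (at p) u
    + frechet_derivative (\<lambda>q. hyp_metric q u w) (at p) v
    - frechet_derivative (\<lambda>q. hyp_metric q u v) (at p) w)"

abbreviation velocity :: "(real \<Rightarrow> complex) \<Rightarrow> real \<Rightarrow> complex" where
  "velocity \<gamma> t \<equiv> vector_derivative \<gamma> (at t)"

definition hyp_covariant_derivative ::
    "(real \<Rightarrow> complex) \<Rightarrow> (real \<Rightarrow> complex) \<Rightarrow> real \<Rightarrow> complex" where
  "hyp_covariant_derivative \<gamma> V t =
     vector_derivative V (at t) + hyp_christoffel (\<gamma> t) (velocity \<gamma> t) (V t)"

text \<open>Closed curves are \<open>2\<pi>\<close>-periodic functions, i.e. functions on the circle \<open>\<real>/2\<pi>\<int>\<close>.\<close>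

definition smooth_closed_curve :: "(real \<Rightarrow> complex) \<Rightarrow> bool" where
  "smooth_closed_curve \<gamma> \<longleftrightarrow>
     (\<forall>t. \<gamma> t \<in> half_plane) \<and>
     (\<forall>t. \<gamma> (t + 2 * pi) = \<gamma> t) \<and>
     (\<forall>n t. (velocity ^^ n) \<gamma> differentiable at t)"

definition immersed :: "(real \<Rightarrow> complex) \<Rightarrow> bool" where
  "immersed \<gamma> \<longleftrightarrow> (\<forall>t. velocity \<gamma> t \<noteq> 0)"

definition hyp_speed :: "(real \<Rightarrow> complex) \<Rightarrow> real \<Rightarrow> real" where
  "hyp_speed \<gamma> t = hyp_norm (\<gamma> t) (velocity \<gamma> t)"

definition unit_tangent :: "(real \<Rightarrow> complex) \<Rightarrow> real \<Rightarrow> complex" where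
  "unit_tangent \<gamma> t = velocity \<gamma> t /\<^sub>R hyp_speed \<gamma> t"

definition unit_normal :: "(real \<Rightarrow> complex) \<Rightarrow> real \<Rightarrow> complex" where
  "unit_normal \<gamma> t = \<i> * unit_tangent \<gamma> t"

text \<open>\<open>\<nabla>\<^sub>T T\<close>: since \<open>T = \<gamma>' / |\<gamma>'|\<close>, covariant differentiation along \<open>T\<close> is covariant
  differentiation in the parameter divided by the speed.\<close>

definition curvature_vector :: "(real \<Rightarrow> complex) \<Rightarrow> real \<Rightarrow> complex" where
  "curvature_vector \<gamma> t = hyp_covariant_derivative \<gamma> (unit_tangent \<gamma>) t /\<^sub>R hyp_speed \<gamma> t"

definition curvature :: "(real \<Rightarrow> complex) \<Rightarrow> real \<Rightarrow> real" where
  "curvature \<gamma> t = (THE k. curvature_vector \<gamma> t = k *\<^sub>R unit_normal \<gamma> t)"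

definition hyp_length :: "(real \<Rightarrow> complex) \<Rightarrow> real" where
  "hyp_length \<gamma> = integral {0..2 * pi} (hyp_speed \<gamma>)"

definition elastic_energy :: "(real \<Rightarrow> complex) \<Rightarrow> real" where
  "elastic_energy \<gamma> = integral {0..2 * pi} (\<lambda>t. (curvature \<gamma> t)\<^sup>2 * hyp_speed \<gamma> t)"

text \<open>The two definite descriptions above are well defined.\<close>

lemma hyp_christoffel_eq:
  assumes "p \<in> half_plane"
  shows "hyp_christoffel p u v = - ((Im u *\<^sub>R v + Im v *\<^sub>R u - (u \<bullet> v) *\<^sub>R \<i>) /\<^sub>R Im p)"
proof -
  have y: "Im p > 0" using assms by (simp add: half_plane_def)
  have fd: "frechet_derivative (\<lambda>q. hyp_metric q a b) (at p) h = - 2 * Im h * (a \<bullet> b) / (Im p)^3"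
    for a b h
  proof -
    have "((\<lambda>q. hyp_metric q a b) has_derivative (\<lambda>h. - 2 * Im h * (a \<bullet> b) / (Im p)^3)) (at p)"
      unfolding hyp_metric_def using y
      by (auto intro!: derivative_eq_intros simp: field_simps power2_eq_square power3_eq_cube)
    from frechet_derivative_at[OF this] show ?thesis by metis
  qed
  define z where "z = - ((Im u *\<^sub>R v + Im v *\<^sub>R u - (u \<bullet> v) *\<^sub>R \<i>) /\<^sub>R Im p)"
  have koszul: "2 * hyp_metric p x w =
      frechet_derivative (\<lambda>q. hyp_metric q v w) (at p) u
    + frechet_derivative (\<lambda>q. hyp_metric q u w) (at p) v
    - frechet_derivative (\<lambda>q. hyp_metric q u v) (at p) w \<longleftrightarrow> x \<bullet> w = z \<bullet> w" for x w
  proof -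
    have zw: "z \<bullet> w = - (Im u * (v \<bullet> w) + Im v * (u \<bullet> w) - (u \<bullet> v) * Im w) / Im p"
    proof -
      have "\<i> \<bullet> w = Im w" by (simp add: inner_complex_def)
      then show ?thesis
        unfolding z_def by (simp add: inner_diff_left inner_add_left divide_inverse algebra_simps)
    qed
    have "(2 * hyp_metric p x w =
        frechet_derivative (\<lambda>q. hyp_metric q v w) (at p) u
      + frechet_derivative (\<lambda>q. hyp_metric q u w) (at p) v
      - frechet_derivative (\<lambda>q. hyp_metric q u v) (at p) w) \<longleftrightarrow>
      2 * (x \<bullet> w) / (Im p)\<^sup>2
        = 2 * (- (Im u * (v \<bullet> w) + Im v * (u \<bullet> w) - (u \<bullet> v) * Im w) / Im p) / (Im p)\<^sup>2"
      unfolding fd unfolding hyp_metric_def using y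
      by (simp add: power2_eq_square power3_eq_cube add_divide_distrib diff_divide_distrib
          algebra_simps)
    moreover have "2 * a / (Im p)\<^sup>2 = 2 * b / (Im p)\<^sup>2 \<longleftrightarrow> a = b" for a b
      using y by simp
    ultimately show ?thesis
      unfolding zw by (simp only:)
  qed
  show ?thesis
    unfolding hyp_christoffel_def koszul z_def[symmetric]
  proof (rule the_equality)
    show "x = z" if "\<forall>w. x \<bullet> w = z \<bullet> w" for x
      using that by (metis inner_commute vector_eq_rdot)
  qed simp
qed

lemma curvature_vector_eq:
  assumes "smooth_closed_curve \<gamma>" "immersed \<gamma>"
  shows "curvature_vector \<gamma> t = curvature \<gamma> t *\<^sub>R unit_normal \<gamma> t"
proof -
  define T where "T = unit_tangent \<gamma>"
  define s where "s = hyp_speed \<gamma>"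
  have y: "Im (\<gamma> t) > 0" for t
    using assms(1) by (simp add: smooth_closed_curve_def half_plane_def)
  have v0: "velocity \<gamma> t \<noteq> 0" for t
    using assms(2) by (simp add: immersed_def)
  have s_eq: "s t = norm (velocity \<gamma> t) / Im (\<gamma> t)" for t
    using y[of t] by (simp add: s_def hyp_speed_def hyp_norm_def hyp_metric_def
        real_sqrt_divide norm_eq_sqrt_inner)
  have s0: "s t > 0" for t using y v0 by (simp add: s_eq)
  have T_eq: "T t = velocity \<gamma> t /\<^sub>R s t" for t
    by (simp add: T_def unit_tangent_def s_def)
  have vT: "velocity \<gamma> t = s t *\<^sub>R T t" for t
    using s0[of t] by (simp add: T_eq)
  have TT: "T t \<bullet> T t = (Im (\<gamma> t))\<^sup>2" for t
    using v0[of t] y[of t] unfolding T_eq s_eq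
    by (simp add: dot_square_norm field_simps power2_eq_square)
  have T0: "T t \<noteq> 0" for t using TT[of t] y[of t] by force
  have d1: "(\<gamma> has_vector_derivative velocity \<gamma> t) (at t)" for t
    using assms(1)[unfolded smooth_closed_curve_def] vector_derivative_works
    by (metis funpow_0)
  have d2: "(velocity \<gamma>) differentiable at t" for t
    using assms(1)[unfolded smooth_closed_curve_def]
    by (metis funpow_0 funpow.simps(2) comp_apply)
  have "Im \<circ> \<gamma> differentiable at t"
    by (rule differentiable_chain_at[OF differentiableI_vector[OF d1]
          bounded_linear_imp_differentiable[OF bounded_linear_Im]])
  moreover have "norm \<circ> velocity \<gamma> differentiable at t"
    by (intro differentiable_chain_at d2 differentiable_norm_at v0)
  ultimately have "s differentiable at t"
    using y[of t] by (simp add: s_eq[abs_def] comp_def)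
  then have "T differentiable at t"
    unfolding T_eq[abs_def] using d2 s0[of t]
    by (intro differentiable_scaleR differentiable_inverse) auto
  then obtain T' where T': "(T has_vector_derivative T') (at t)"
    by (metis vector_derivative_works)
  have "((\<lambda>t. T t \<bullet> T t) has_vector_derivative 2 * (T t \<bullet> T')) (at t)"
    using T' by (auto intro!: derivative_eq_intros simp: has_vector_derivative_def inner_commute)
  moreover have "((\<lambda>t. (Im (\<gamma> t))\<^sup>2) has_vector_derivative
      2 * (Im (\<gamma> t) * Im (velocity \<gamma> t))) (at t)"
    using d1[of t] by (auto intro!: derivative_eq_intros simp: has_vector_derivative_def)
  ultimately have TT': "T t \<bullet> T' = Im (\<gamma> t) * (s t * Im (T t))"
    unfolding TT using vector_derivative_unique_at vT[of t] by fastforce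
  define K where "K = curvature_vector \<gamma> t"
  have K: "K = (T' + hyp_christoffel (\<gamma> t) (s t *\<^sub>R T t) (T t)) /\<^sub>R s t"
    unfolding K_def curvature_vector_def hyp_covariant_derivative_def
    using vector_derivative_at[OF T'] by (simp add: T_def[symmetric] s_def[symmetric] vT)
  have "T t \<bullet> hyp_christoffel (\<gamma> t) (s t *\<^sub>R T t) (T t) = - (Im (\<gamma> t) * (s t * Im (T t)))"
  proof -
    have "\<gamma> t \<in> half_plane" using y by (simp add: half_plane_def)
    moreover have "T t \<bullet> \<i> = Im (T t)" "T t \<bullet> (T t * 2) = 2 * (T t \<bullet> T t)"
      by (simp_all add: inner_complex_def)
    ultimately show ?thesis
      using y[of t] TT[of t]
      by (simp add: hyp_christoffel_eq inner_diff_right inner_add_right field_simps power2_eq_square)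
  qed
  then have "T t \<bullet> K = 0"
    unfolding K by (simp add: inner_add_right TT')
  then have "\<exists>k. K = k *\<^sub>R (\<i> * T t)"
  proof -
    assume o: "T t \<bullet> K = 0"
    define k where "k = ((\<i> * T t) \<bullet> K) / (T t \<bullet> T t)"
    have "K * (T t \<bullet> T t) = ((\<i> * T t) \<bullet> K) *\<^sub>R (\<i> * T t) + (T t \<bullet> K) *\<^sub>R T t"
      by (simp add: complex_eq_iff inner_complex_def algebra_simps)
    then have "K = k *\<^sub>R (\<i> * T t)"
      using o T0[of t] by (simp add: k_def complex_eq_iff field_simps)
    then show ?thesis ..
  qed
  then obtain k where k: "K = k *\<^sub>R (\<i> * T t)" ..
  have "curvature \<gamma> t = k"
    unfolding curvature_def K_def[symmetric] unit_normal_def T_def[symmetric] k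
    using T0[of t] by (intro the_equality) auto
  with k show ?thesis
    by (simp add: K_def unit_normal_def T_def)
qed

end

(*
  Lower bound. Along a closed curve, follow two Busemann functions whose gradients at a base point
  are tangent to the curve, one pointing forward (P) and one backward (Q). If w denotes the
  tangential component of such a gradient, then E + 4 w is nondecreasing, where E is the energy
  accumulated so far; hence w_Q - w_P <= (energy - 8) / 4 everywhere. The difference V of the two
  Busemann functions has arclength derivative w_Q - w_P and returns to 0, which forces energy >= 8.
  If the energy is at most 16 - d, the difference w_Q - w_P stays away from 2 and V is bounded
  below by -144 / d. On a window of length 144 / d + 1 with almost no energy the curve is nearly
  geodesic and V would drop by more than that. So every such window carries a definite amount of
  energy, and the length is bounded.

  Sharpness. A hyperbolic catenary (x, y) = c (s, cosh s) in arclength s has curvature 2 / cosh s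
  and energy 8. Its two ends can be bent onto a common geodesic at arbitrarily small energy cost,
  and two such catenaries, arbitrarily far apart, close up along that geodesic.
*)
theory Submission
  imports Defs "HOL-Real_Asymp.Real_Asymp"
begin

subsection \<open>The lower bound\<close>

text \<open>The factor 4 completes a square: the arclength derivative of \<open>E + 4 w\<close> is
  \<open>(\<kappa> + 2 n)^2\<close>, where \<open>n\<close> is the normal component of the gradient.
  For the Busemann function \<open>- ln y\<close> the catenary satisfies
  \<open>\<kappa> = - 2 n\<close> identically while \<open>w\<close> falls from 1 to -1. So 8 is the
  exact price of turning a gradient from forward to backward, and the curves that show sharpness are
  made of equality cases of the estimate. Why 16: after falling, \<open>V\<close> must climb back to
  0, which it does only where \<open>w_Q > w_P\<close>. The climb costs energy except when
  \<open>w_Q - w_P\<close> is near 2, where both gradients lie along the curve and a geodesic raises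
  \<open>V\<close> for free. A difference of 2 requires a full turn of the gradient of P before that
  point and a full turn back of that of Q after it, hence 8 + 8. An energy bound below 16 excludes
  the free climb, and this is what limits the depth of \<open>V\<close>.\<close>

lemma has_vector_derivative_shift_arg:
  assumes "(f has_vector_derivative d) (at (t + p))"
  shows "((\<lambda>s. f (s + p)) has_vector_derivative d) (at t)"
proof -
  have "((\<lambda>s. s + p) has_vector_derivative 1) (at t)"
    by (auto intro!: derivative_eq_intros)
  from vector_diff_chain_at[OF this assms] show ?thesis by (simp add: o_def)
qed

lemma vector_derivative_periodic:
  assumes "\<And>s. (f has_vector_derivative vector_derivative f (at s)) (at s)"
    and "\<And>s. f (s + p) = f s"
  shows "vector_derivative f (at (t + p)) = vector_derivative f (at t)"
proof -
  have "(f has_vector_derivative vector_derivative f (at (t + p))) (at t)"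
    using has_vector_derivative_shift_arg[OF assms(1), of p t] unfolding assms(2) .
  then show ?thesis by (simp add: vector_derivative_at)
qed

section \<open>Tangent angle, curvature and periodicity of a closed immersed curve\<close>

locale closed_immersed_curve =
  fixes \<gamma> :: "real \<Rightarrow> complex"
  assumes smooth: "smooth_closed_curve \<gamma>" and imm: "immersed \<gamma>"
begin

abbreviation \<sigma> where "\<sigma> \<equiv> hyp_speed \<gamma>"
abbreviation \<kappa> where "\<kappa> \<equiv> curvature \<gamma>"
abbreviation y where "y t \<equiv> Im (\<gamma> t)"

text \<open>The Euclidean unit tangent: its constant norm makes it an angle, and its evolution a
  scalar equation.\<close>

definition e :: "real \<Rightarrow> complex" where "e t = sgn (velocity \<gamma> t)"

lemma y_pos: "y t > 0"
  using smooth by (simp add: smooth_closed_curve_def half_plane_def)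

lemma velocity_nonzero: "velocity \<gamma> t \<noteq> 0"
  using imm by (simp add: immersed_def)

lemma norm_e [simp]: "norm (e t) = 1"
  using velocity_nonzero by (simp add: e_def norm_sgn)

lemma e_nonzero [simp]: "e t \<noteq> 0"
  using norm_e[of t] by force

lemma e_squares: "(Re (e t))\<^sup>2 + (Im (e t))\<^sup>2 = 1"
  using norm_e[of t] by (simp add: cmod_def)

lemma speed_eq: "\<sigma> t = norm (velocity \<gamma> t) / y t"
  using y_pos[of t] by (simp add: hyp_speed_def hyp_norm_def hyp_metric_def
        real_sqrt_divide norm_eq_sqrt_inner)

lemma speed_pos: "\<sigma> t > 0"
  using y_pos velocity_nonzero by (simp add: speed_eq)

lemma velocity_eq: "velocity \<gamma> t = of_real (\<sigma> t * y t) * e t"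
  using y_pos[of t] velocity_nonzero[of t]
  by (simp add: speed_eq e_def sgn_eq)

lemma has_velocity: "(\<gamma> has_vector_derivative velocity \<gamma> t) (at t)"
  using smooth[unfolded smooth_closed_curve_def] vector_derivative_works
  by (metis funpow_0)

lemma has_acceleration:
  "(velocity \<gamma> has_vector_derivative vector_derivative (velocity \<gamma>) (at t)) (at t)"
  using smooth[unfolded smooth_closed_curve_def] vector_derivative_works
  by (metis funpow_0 funpow.simps(2) comp_apply)

lemma acceleration_differentiable:
  "(\<lambda>t. vector_derivative (velocity \<gamma>) (at t)) differentiable at t"
proof -
  have "(velocity ^^ 2) \<gamma> = (\<lambda>t. vector_derivative (velocity \<gamma>) (at t))"
    by (simp add: numeral_2_eq_2)
  then show ?thesis
    using smooth[unfolded smooth_closed_curve_def] by metis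
qed

lemma continuous_curve: "continuous_on UNIV \<gamma>"
  by (intro continuous_at_imp_continuous_on ballI has_vector_derivative_continuous[OF has_velocity])

lemma continuous_velocity: "continuous_on UNIV (velocity \<gamma>)"
  by (intro continuous_at_imp_continuous_on ballI has_vector_derivative_continuous[OF has_acceleration])

lemma continuous_acceleration:
  "continuous_on UNIV (\<lambda>t. vector_derivative (velocity \<gamma>) (at t))"
  by (intro continuous_at_imp_continuous_on ballI differentiable_imp_continuous_within
      acceleration_differentiable)

lemma e_differentiable: "e differentiable at t"
proof -
  have "velocity \<gamma> differentiable at t"
    using has_acceleration differentiableI_vector by blast
  moreover from this have "norm \<circ> velocity \<gamma> differentiable at t"
    by (intro differentiable_chain_at differentiable_norm_at velocity_nonzero)
  ultimately show ?thesis
    unfolding e_def[abs_def] sgn_div_norm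
    by (intro differentiable_scaleR differentiable_inverse) (auto simp: velocity_nonzero comp_def)
qed

lemma has_derivative_y: "(y has_real_derivative \<sigma> t * y t * Im (e t)) (at t)"
proof -
  have "(y has_vector_derivative Im (velocity \<gamma> t)) (at t)"
    by (rule bounded_linear.has_vector_derivative[OF bounded_linear_Im has_velocity])
  then show ?thesis
    by (simp add: velocity_eq has_real_derivative_iff_has_vector_derivative)
qed

lemma has_derivative_x:
  "((\<lambda>t. Re (\<gamma> t)) has_real_derivative \<sigma> t * y t * Re (e t)) (at t)"
proof -
  have "((\<lambda>t. Re (\<gamma> t)) has_vector_derivative Re (velocity \<gamma> t)) (at t)"
    by (rule bounded_linear.has_vector_derivative[OF bounded_linear_Re has_velocity])
  then show ?thesis
    by (simp add: velocity_eq has_real_derivative_iff_has_vector_derivative)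
qed

text \<open>With \<open>e = cis \<theta>\<close> this says that the tangent angle turns at rate
  \<open>\<kappa> - cos \<theta>\<close> per arclength; a horizontal horocycle,
  \<open>\<kappa> = 1\<close> and \<open>\<theta> = 0\<close>, does not turn. From here on the
  connection enters only through this formula.\<close>

lemma e_deriv: "(e has_vector_derivative of_real (\<sigma> t * (\<kappa> t - Re (e t))) * \<i> * e t) (at t)"
proof -
  obtain e' where e': "(e has_vector_derivative e') (at t)"
    using e_differentiable vector_derivative_works by blast
  have T: "unit_tangent \<gamma> = (\<lambda>t. of_real (y t) * e t)"
  proof
    show "unit_tangent \<gamma> s = of_real (y s) * e s" for s
      using speed_pos[of s]
      by (simp add: unit_tangent_def velocity_eq scaleR_conv_of_real)
  qed
  have "((\<lambda>t. of_real (y t) * e t) has_vector_derivative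
      of_real (y t) * e' + of_real (\<sigma> t * y t * Im (e t)) * e t) (at t)"
    by (rule has_vector_derivative_mult[OF _ e'])
      (intro has_vector_derivative_of_real has_derivative_y)
  then have T': "vector_derivative (unit_tangent \<gamma>) (at t)
      = of_real (y t) * e' + of_real (\<sigma> t * y t * Im (e t)) * e t"
    unfolding T by (rule vector_derivative_at)
  have hp: "\<gamma> t \<in> half_plane" using y_pos by (simp add: half_plane_def)
  have inn: "e t \<bullet> e t = 1"
    using dot_square_norm[of "e t"] by simp
  have chr: "hyp_christoffel (\<gamma> t) (velocity \<gamma> t) (unit_tangent \<gamma> t)
     = - of_real (2 * \<sigma> t * y t * Im (e t)) * e t + of_real (\<sigma> t * y t) * \<i>"
  proof -
    have "(a *\<^sub>R e t) \<bullet> (b *\<^sub>R e t) = a * b" for a b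
      by (simp add: inn)
    then have "Im (a *\<^sub>R e t) *\<^sub>R (b *\<^sub>R e t) + Im (b *\<^sub>R e t) *\<^sub>R (a *\<^sub>R e t)
        - ((a *\<^sub>R e t) \<bullet> (b *\<^sub>R e t)) *\<^sub>R \<i> = b *\<^sub>R ((2 * a * Im (e t)) *\<^sub>R e t - a *\<^sub>R \<i>)" for a b
      by (simp add: algebra_simps flip: scaleR_add_left)
    from this[of "\<sigma> t * y t" "y t"] have "hyp_christoffel (\<gamma> t) (velocity \<gamma> t) (unit_tangent \<gamma> t)
        = - (y t *\<^sub>R ((2 * (\<sigma> t * y t) * Im (e t)) *\<^sub>R e t - (\<sigma> t * y t) *\<^sub>R \<i>) /\<^sub>R y t)"
      unfolding hyp_christoffel_eq[OF hp] velocity_eq T by (simp only: scaleR_conv_of_real)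
    also have "\<dots> = - ((2 * (\<sigma> t * y t) * Im (e t)) *\<^sub>R e t - (\<sigma> t * y t) *\<^sub>R \<i>)"
      using y_pos[of t] by simp
    finally show ?thesis
      by (simp add: scaleR_conv_of_real)
  qed
  have "hyp_covariant_derivative \<gamma> (unit_tangent \<gamma>) t = \<sigma> t *\<^sub>R curvature_vector \<gamma> t"
    using speed_pos[of t] by (simp add: curvature_vector_def)
  also have "\<dots> = of_real (\<sigma> t * \<kappa> t * y t) * \<i> * e t"
    unfolding curvature_vector_eq[OF smooth imm]
    by (simp add: unit_normal_def T scaleR_conv_of_real)
  finally have eq: "of_real (y t) * e' + of_real (\<sigma> t * y t * Im (e t)) * e t
      - of_real (2 * \<sigma> t * y t * Im (e t)) * e t + of_real (\<sigma> t * y t) * \<i>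
      = of_real (\<sigma> t * \<kappa> t * y t) * \<i> * e t"
    unfolding hyp_covariant_derivative_def T' chr by (simp add: algebra_simps)
  \<comment> \<open>The vertical direction in the frame \<open>e\<close>, \<open>\<i> * e\<close>.
    Its part along \<open>e\<close> cancels below, as it must for a field of unit length.\<close>
  have i_eq: "\<i> = of_real (Im (e t)) * e t + of_real (Re (e t)) * (\<i> * e t)"
    using e_squares[of t] by (simp add: complex_eq_iff power2_eq_square algebra_simps)
  have "of_real (y t) * e' = (of_real (y t) * e' + of_real (\<sigma> t * y t * Im (e t)) * e t
      - of_real (2 * \<sigma> t * y t * Im (e t)) * e t + of_real (\<sigma> t * y t) * \<i>)
      + of_real (\<sigma> t * y t * Im (e t)) * e t - of_real (\<sigma> t * y t) * \<i>"
    by (simp add: algebra_simps)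
  also have "\<dots> = of_real (\<sigma> t * \<kappa> t * y t) * \<i> * e t + of_real (\<sigma> t * y t * Im (e t)) * e t
      - of_real (\<sigma> t * y t) * (of_real (Im (e t)) * e t + of_real (Re (e t)) * (\<i> * e t))"
    unfolding eq by (subst i_eq[symmetric]) simp
  also have "\<dots> = of_real (y t) * (of_real (\<sigma> t * (\<kappa> t - Re (e t))) * \<i> * e t)"
    by (simp add: algebra_simps)
  finally have "of_real (y t) * e' = \<dots>" .
  then have "e' = of_real (\<sigma> t * (\<kappa> t - Re (e t))) * \<i> * e t"
    using y_pos[of t] by simp
  with e' show ?thesis by simp
qed

text \<open>The curvature is a definite description; in this form its continuity and periodicity
  follow from those of the first two derivatives, and it can be computed for explicit curves. The
  first term is the Euclidean turning rate, the second the contribution of the metric.\<close>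

lemma curvature_times_speed:
  "\<kappa> t * \<sigma> t = Im (vector_derivative (velocity \<gamma>) (at t) / velocity \<gamma> t)
      + Re (velocity \<gamma> t) / y t"
proof -
  define r where "r = (\<lambda>t. norm (velocity \<gamma> t))"
  have v: "velocity \<gamma> t = of_real (r t) * e t" for t
    by (simp add: r_def e_def sgn_eq)
  have r0: "r t > 0" for t by (simp add: r_def velocity_nonzero)
  have "norm \<circ> velocity \<gamma> differentiable at t"
    using has_acceleration differentiableI_vector
    by (intro differentiable_chain_at differentiable_norm_at velocity_nonzero) blast
  then obtain r' where r': "(r has_real_derivative r') (at t)"
    unfolding r_def comp_def has_real_derivative_iff_has_vector_derivative
    using vector_derivative_works by blast
  have "((\<lambda>t. of_real (r t) * e t) has_vector_derivative
     of_real (r t) * (of_real (\<sigma> t * (\<kappa> t - Re (e t))) * \<i> * e t) + of_real r' * e t) (at t)"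
    by (rule has_vector_derivative_mult[OF has_vector_derivative_of_real[OF r'] e_deriv])
  then have acc: "vector_derivative (velocity \<gamma>) (at t) =
     of_real (r t) * (of_real (\<sigma> t * (\<kappa> t - Re (e t))) * \<i> * e t) + of_real r' * e t"
    unfolding v[abs_def] by (rule vector_derivative_at)
  have "vector_derivative (velocity \<gamma>) (at t) / velocity \<gamma> t
      = of_real (\<sigma> t * (\<kappa> t - Re (e t))) * \<i> + of_real (r' / r t)"
    unfolding acc unfolding v using r0[of t] by (simp add: add_divide_distrib)
  then have "Im (vector_derivative (velocity \<gamma>) (at t) / velocity \<gamma> t) = \<sigma> t * (\<kappa> t - Re (e t))"
    by simp
  moreover have "Re (velocity \<gamma> t) / y t = \<sigma> t * Re (e t)"
    using y_pos[of t] by (simp add: velocity_eq)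
  ultimately show ?thesis by (simp add: algebra_simps)
qed

lemma continuous_speed: "continuous_on UNIV \<sigma>"
proof -
  have "continuous_on UNIV (\<lambda>t. norm (velocity \<gamma> t) / y t)"
    by (intro continuous_intros continuous_velocity continuous_curve)
      (simp add: less_imp_neq[OF y_pos, symmetric])
  then show ?thesis by (simp add: speed_eq[abs_def])
qed

lemma continuous_curvature: "continuous_on UNIV \<kappa>"
proof -
  have "\<kappa> = (\<lambda>t. (Im (vector_derivative (velocity \<gamma>) (at t) / velocity \<gamma> t)
      + Re (velocity \<gamma> t) / y t) / \<sigma> t)"
    by (simp add: fun_eq_iff less_imp_neq[OF speed_pos, symmetric] flip: curvature_times_speed)
  moreover have "continuous_on UNIV \<dots>"
    by (intro continuous_intros continuous_velocity continuous_curve continuous_acceleration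
        continuous_speed) (simp_all add: velocity_nonzero less_imp_neq[OF y_pos, symmetric]
        less_imp_neq[OF speed_pos, symmetric])
  ultimately show ?thesis by simp
qed

lemma curve_periodic: "\<gamma> (t + 2 * pi) = \<gamma> t"
  using smooth by (simp add: smooth_closed_curve_def)

lemma velocity_periodic: "velocity \<gamma> (t + 2 * pi) = velocity \<gamma> t"
  by (rule vector_derivative_periodic[OF has_velocity]) (simp add: curve_periodic)

lemma acceleration_periodic:
  "vector_derivative (velocity \<gamma>) (at (t + 2 * pi)) = vector_derivative (velocity \<gamma>) (at t)"
  by (rule vector_derivative_periodic[OF has_acceleration]) (simp add: velocity_periodic)

lemma e_periodic: "e (t + 2 * pi) = e t"
  by (simp add: e_def velocity_periodic)

lemma speed_periodic: "\<sigma> (t + 2 * pi) = \<sigma> t"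
  by (simp add: speed_eq velocity_periodic curve_periodic)

lemma curvature_periodic: "\<kappa> (t + 2 * pi) = \<kappa> t"
proof -
  have "\<kappa> (t + 2 * pi) * \<sigma> t = \<kappa> t * \<sigma> t"
    using curvature_times_speed[of t] curvature_times_speed[of "t + 2 * pi"]
    by (simp only: speed_periodic velocity_periodic acceleration_periodic curve_periodic)
  then show ?thesis using speed_pos[of t] by simp
qed

text \<open>Antiderivatives on the whole line replace integrals: later estimates become monotonicity
  statements, and a full period is a jump by the total.\<close>

lemma obtains_arclength_energy:
  obtains S K where
    "\<And>t. (S has_real_derivative \<sigma> t) (at t)"
    "\<And>t. (K has_real_derivative (\<kappa> t)\<^sup>2 * \<sigma> t) (at t)"
    "\<And>t. S (t + 2 * pi) = S t + hyp_length \<gamma>"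
    "\<And>t. K (t + 2 * pi) = K t + elastic_energy \<gamma>"
proof -
  have prim: "\<exists>F. (\<forall>t. (F has_real_derivative f t) (at t)) \<and>
      (\<forall>t. F (t + 2 * pi) = F t + integral {0..2 * pi} f)"
    if c: "continuous_on UNIV f" and p: "\<And>t. f (t + 2 * pi) = f t" for f :: "real \<Rightarrow> real"
  proof -
    from c have "isCont f x" for x by (simp add: continuous_on_eq_continuous_at)
    then obtain F where F: "(F has_real_derivative f x) (at x)" for x
      using einterval_antiderivative[of "-\<infinity>" "\<infinity>" f]
      by (auto simp: has_real_derivative_iff_has_vector_derivative)
    have "((\<lambda>t. F (t + 2 * pi)) has_real_derivative f (x + 2 * pi)) (at x)" for x
      using F[of "x + 2 * pi"] by (simp add: DERIV_shift)
    then have "((\<lambda>t. F (t + 2 * pi) - F t) has_real_derivative 0) (at x)" for x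
      using DERIV_diff[OF _ F[of x], of "\<lambda>t. F (t + 2 * pi)" "f x"] p[of x]
      by (metis diff_self)
    then have "F (t + 2 * pi) - F t = F (0 + 2 * pi) - F 0" for t
      by (intro DERIV_isconst_all) blast
    moreover have "(f has_integral (F (2 * pi) - F 0)) {0..2 * pi}"
      by (rule fundamental_theorem_of_calculus)
        (auto intro: has_vector_derivative_at_within simp: F[unfolded has_real_derivative_iff_has_vector_derivative])
    ultimately show ?thesis
      using F by (intro exI[of _ F]) (simp add: integral_unique, metis add.commute diff_add_cancel)
  qed
  obtain S where "\<And>t. (S has_real_derivative \<sigma> t) (at t)"
    "\<And>t. S (t + 2 * pi) = S t + hyp_length \<gamma>"
    using prim[OF continuous_speed speed_periodic] by (auto simp: hyp_length_def)
  moreover have "continuous_on UNIV (\<lambda>t. (\<kappa> t)\<^sup>2 * \<sigma> t)"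
    by (intro continuous_intros continuous_speed continuous_curvature)
  from prim[OF this] obtain K where "\<And>t. (K has_real_derivative (\<kappa> t)\<^sup>2 * \<sigma> t) (at t)"
    "\<And>t. K (t + 2 * pi) = K t + elastic_energy \<gamma>"
    by (auto simp: elastic_energy_def speed_periodic curvature_periodic)
  ultimately show ?thesis using that by blast
qed

section \<open>Busemann functions along the curve\<close>

text \<open>For real \<open>\<alpha>\<close>, \<open>\<beta>\<close> put \<open>m = X + \<i> Y = \<alpha> \<gamma> + \<beta>\<close>. Then \<open>ln (\<bar>m\<bar>\<^sup>2 / y)\<close> is a Busemann function of the ideal
  point \<open>- \<beta> / \<alpha>\<close>, and \<open>- n + \<i> w = m\<^sup>2 cnj e / \<bar>m\<bar>\<^sup>2\<close>: up to signs \<open>w\<close> and \<open>n\<close> are the components of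
  its unit gradient along the tangent and the normal of the curve.\<close>

definition X where "X \<alpha> \<beta> t = \<alpha> * Re (\<gamma> t) + (\<beta>::real)"
definition Y where "Y \<alpha> t = \<alpha> * y t"
definition D where "D \<alpha> \<beta> t = (X \<alpha> \<beta> t)\<^sup>2 + (Y \<alpha> t)\<^sup>2"
definition w where "w \<alpha> \<beta> t = (2 * X \<alpha> \<beta> t * Y \<alpha> t * Re (e t)
    - ((X \<alpha> \<beta> t)\<^sup>2 - (Y \<alpha> t)\<^sup>2) * Im (e t)) / D \<alpha> \<beta> t"
definition n where "n \<alpha> \<beta> t = - (((X \<alpha> \<beta> t)\<^sup>2 - (Y \<alpha> t)\<^sup>2) * Re (e t)
    + 2 * X \<alpha> \<beta> t * Y \<alpha> t * Im (e t)) / D \<alpha> \<beta> t"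

lemma D_pos:
  assumes "\<alpha> \<noteq> 0 \<or> \<beta> \<noteq> 0"
  shows "D \<alpha> \<beta> t > 0"
  using assms y_pos[of t] by (cases "\<alpha> = 0") (auto simp: D_def X_def Y_def add_nonneg_pos)

lemma n_w_squares:
  assumes "\<alpha> \<noteq> 0 \<or> \<beta> \<noteq> 0"
  shows "(n \<alpha> \<beta> t)\<^sup>2 + (w \<alpha> \<beta> t)\<^sup>2 = 1"
proof -
  have "(((X \<alpha> \<beta> t)\<^sup>2 - (Y \<alpha> t)\<^sup>2) * Re (e t) + 2 * X \<alpha> \<beta> t * Y \<alpha> t * Im (e t))\<^sup>2
      + (2 * X \<alpha> \<beta> t * Y \<alpha> t * Re (e t) - ((X \<alpha> \<beta> t)\<^sup>2 - (Y \<alpha> t)\<^sup>2) * Im (e t))\<^sup>2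
      = (D \<alpha> \<beta> t)\<^sup>2 * ((Re (e t))\<^sup>2 + (Im (e t))\<^sup>2)"
    unfolding D_def by (simp add: power2_eq_square algebra_simps)
  then show ?thesis
    using D_pos[OF assms, of t] e_squares[of t]
    by (simp add: n_def w_def power_divide power2_minus flip: add_divide_distrib del: minus_add_distrib)
qed

lemma X_deriv: "(X \<alpha> \<beta> has_real_derivative \<sigma> t * Y \<alpha> t * Re (e t)) (at t)"
  unfolding X_def[abs_def] Y_def
  by (rule DERIV_cong[OF DERIV_add[OF DERIV_cmult[OF has_derivative_x] DERIV_const]]) simp

lemma Y_deriv: "(Y \<alpha> has_real_derivative \<sigma> t * Y \<alpha> t * Im (e t)) (at t)"
  unfolding Y_def[abs_def]
  by (rule DERIV_cong[OF DERIV_cmult[OF has_derivative_y]]) simp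

lemma D_deriv: "(D \<alpha> \<beta> has_real_derivative
    2 * \<sigma> t * Y \<alpha> t * (X \<alpha> \<beta> t * Re (e t) + Y \<alpha> t * Im (e t))) (at t)"
  unfolding D_def[abs_def]
  by (auto intro!: derivative_eq_intros X_deriv Y_deriv simp: algebra_simps)

lemma Re_e_deriv: "((\<lambda>t. Re (e t)) has_real_derivative - \<sigma> t * (\<kappa> t - Re (e t)) * Im (e t)) (at t)"
  using bounded_linear.has_vector_derivative[OF bounded_linear_Re e_deriv[of t]]
  by (simp add: has_real_derivative_iff_has_vector_derivative)

lemma Im_e_deriv: "((\<lambda>t. Im (e t)) has_real_derivative \<sigma> t * (\<kappa> t - Re (e t)) * Re (e t)) (at t)"
  using bounded_linear.has_vector_derivative[OF bounded_linear_Im e_deriv[of t]]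
  by (simp add: has_real_derivative_iff_has_vector_derivative)

lemma ln_height_deriv:
  assumes "\<alpha> \<noteq> 0 \<or> \<beta> \<noteq> 0"
  shows "((\<lambda>t. ln (D \<alpha> \<beta> t / y t)) has_real_derivative \<sigma> t * w \<alpha> \<beta> t) (at t)"
proof -
  have D0: "D \<alpha> \<beta> s > 0" for s by (rule D_pos[OF assms])
  have "((\<lambda>t. ln (D \<alpha> \<beta> t) - ln (y t)) has_real_derivative
      2 * \<sigma> t * Y \<alpha> t * (X \<alpha> \<beta> t * Re (e t) + Y \<alpha> t * Im (e t)) / D \<alpha> \<beta> t
      - \<sigma> t * Im (e t)) (at t)"
    using y_pos[of t]
    by (intro DERIV_cong[OF DERIV_diff[OF
          DERIV_chain2[OF DERIV_ln_divide[OF D0] D_deriv]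
          DERIV_chain2[OF DERIV_ln_divide[OF y_pos] has_derivative_y]]]) simp
  also have "2 * \<sigma> t * Y \<alpha> t * (X \<alpha> \<beta> t * Re (e t) + Y \<alpha> t * Im (e t)) / D \<alpha> \<beta> t
      - \<sigma> t * Im (e t) = (\<sigma> t * (2 * Y \<alpha> t * (X \<alpha> \<beta> t * Re (e t) + Y \<alpha> t * Im (e t))
        - D \<alpha> \<beta> t * Im (e t))) / D \<alpha> \<beta> t"
    using D0[of t] by (simp add: field_simps)
  also have "\<dots> = \<sigma> t * w \<alpha> \<beta> t"
    unfolding w_def by (simp add: D_def power2_eq_square algebra_simps)
  finally show ?thesis
    by (simp add: ln_div less_imp_neq[OF D0, symmetric] less_imp_neq[OF y_pos, symmetric])
qed

text \<open>A Busemann function \<open>b\<close> has Hessian \<open>g - db^2\<close>, so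
  \<open>w = db(T)\<close> changes at rate \<open>1 - w^2 + \<kappa> * db(N)\<close> per arclength,
  where \<open>n = db(N)\<close> and \<open>1 - w^2 = n^2\<close>. The proof checks this by direct
  computation. Along a geodesic \<open>w = 1\<close> attracts and \<open>w = -1\<close>
  repels.\<close>

lemma w_deriv:
  assumes "\<alpha> \<noteq> 0 \<or> \<beta> \<noteq> 0"
  shows "(w \<alpha> \<beta> has_real_derivative
    \<sigma> t * ((n \<alpha> \<beta> t)\<^sup>2 + \<kappa> t * n \<alpha> \<beta> t)) (at t)"
proof -
  have D0: "D \<alpha> \<beta> t \<noteq> 0" using D_pos[OF assms, of t] by simp
  define x' y' c s N R where defs: "x' = X \<alpha> \<beta> t" "y' = Y \<alpha> t" "c = Re (e t)" "s = Im (e t)"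
    "N = 2 * x' * y' * c - (x'\<^sup>2 - y'\<^sup>2) * s" "R = (x'\<^sup>2 - y'\<^sup>2) * c + 2 * x' * y' * s"
  have Dt: "D \<alpha> \<beta> t = x'\<^sup>2 + y'\<^sup>2" by (simp add: D_def defs)
  have "((\<lambda>t. 2 * X \<alpha> \<beta> t * Y \<alpha> t * Re (e t)
      - ((X \<alpha> \<beta> t)\<^sup>2 - (Y \<alpha> t)\<^sup>2) * Im (e t)) has_real_derivative
      \<sigma> t * (2 * y'\<^sup>2 * (c\<^sup>2 + s\<^sup>2) - (\<kappa> t - c) * R)) (at t)"
    unfolding power2_eq_square
    by (rule DERIV_cong[OF DERIV_diff[OF
          DERIV_mult[OF DERIV_mult[OF DERIV_cmult[OF X_deriv] Y_deriv] Re_e_deriv]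
          DERIV_mult[OF DERIV_diff[OF DERIV_mult[OF X_deriv X_deriv] DERIV_mult[OF Y_deriv Y_deriv]]
            Im_e_deriv]]])
      (simp add: defs power2_eq_square algebra_simps)
  from DERIV_divide[OF this D_deriv D0]
  have "(w \<alpha> \<beta> has_real_derivative (\<sigma> t * (2 * y'\<^sup>2 * (c\<^sup>2 + s\<^sup>2) - (\<kappa> t - c) * R) * D \<alpha> \<beta> t
      - N * (2 * \<sigma> t * y' * (x' * c + y' * s))) / (D \<alpha> \<beta> t * D \<alpha> \<beta> t)) (at t)"
    unfolding w_def[abs_def] defs by simp
  moreover have "\<sigma> t * (2 * y'\<^sup>2 * (c\<^sup>2 + s\<^sup>2) - (\<kappa> t - c) * R) * D \<alpha> \<beta> t
      - N * (2 * \<sigma> t * y' * (x' * c + y' * s)) = \<sigma> t * (R\<^sup>2 - \<kappa> t * R * D \<alpha> \<beta> t)"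
    unfolding Dt defs(5,6) by (simp add: power2_eq_square algebra_simps)
  moreover have "\<sigma> t * (R\<^sup>2 - \<kappa> t * R * D \<alpha> \<beta> t) / (D \<alpha> \<beta> t * D \<alpha> \<beta> t)
      = \<sigma> t * ((n \<alpha> \<beta> t)\<^sup>2 + \<kappa> t * n \<alpha> \<beta> t)"
  proof -
    have n: "n \<alpha> \<beta> t = - R / D \<alpha> \<beta> t" by (simp add: n_def defs)
    show ?thesis unfolding n using D0 by (simp add: power2_eq_square field_simps)
  qed
  ultimately show ?thesis by simp
qed

lemma w_periodic: "w \<alpha> \<beta> (t + 2 * pi) = w \<alpha> \<beta> t"
  by (simp add: w_def X_def Y_def D_def curve_periodic e_periodic)

lemma height_periodic: "D \<alpha> \<beta> (t + 2 * pi) / y (t + 2 * pi) = D \<alpha> \<beta> t / y t"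
  by (simp add: X_def Y_def D_def curve_periodic)

text \<open>The gradient direction depends on \<open>m^2\<close>, hence the square root:
  \<open>m^2 = y u\<close> turns \<open>m^2 cnj e / |m|^2\<close> into \<open>u * cnj e\<close>. The
  modulus \<open>|m|^2 = y\<close> normalises the Busemann function to 0 at
  \<open>a\<close>.\<close>

lemma initial_direction:
  assumes "norm u = 1"
  obtains \<alpha> \<beta> where "\<alpha> \<noteq> 0 \<or> \<beta> \<noteq> 0" "D \<alpha> \<beta> a / y a = 1" "w \<alpha> \<beta> a = Im (u * cnj (e a))"
proof -
  define m where "m = csqrt (of_real (y a) * u)"
  define \<alpha> where "\<alpha> = Im m / y a"
  define \<beta> where "\<beta> = Re m - \<alpha> * Re (\<gamma> a)"
  have y0: "y a > 0" by (rule y_pos)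
  have XY: "X \<alpha> \<beta> a = Re m" "Y \<alpha> a = Im m"
    using y0 by (simp_all add: X_def Y_def \<alpha>_def \<beta>_def)
  have m2: "m\<^sup>2 = of_real (y a) * u" by (simp add: m_def)
  have Da: "D \<alpha> \<beta> a = y a"
  proof -
    have "D \<alpha> \<beta> a = norm (m\<^sup>2)" by (simp add: D_def XY norm_power cmod_power2)
    then show ?thesis using assms y0 unfolding m2 by (simp add: norm_mult)
  qed
  have "w \<alpha> \<beta> a = Im (m\<^sup>2 * cnj (e a)) / y a"
    unfolding w_def Da XY by (simp add: Im_power2 Re_power2)
  also have "\<dots> = y a * Im (u * cnj (e a)) / y a"
    unfolding m2 by (simp add: algebra_simps)
  finally have "w \<alpha> \<beta> a = Im (u * cnj (e a))"
    using y0 by simp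
  moreover have "\<alpha> \<noteq> 0 \<or> \<beta> \<noteq> 0"
  proof (rule ccontr)
    assume "\<not> ?thesis"
    then have "D \<alpha> \<beta> a = 0" by (simp add: D_def X_def Y_def)
    with Da y0 show False by simp
  qed
  ultimately show ?thesis using that Da y0 by simp
qed

section \<open>Energy and length estimates from a pair of Busemann functions\<close>

lemma energy_mono:
  assumes K: "\<And>t. (K has_real_derivative (\<kappa> t)\<^sup>2 * \<sigma> t) (at t)"
    and nz: "\<alpha> \<noteq> 0 \<or> \<beta> \<noteq> 0" and "a \<le> b"
  shows "K a + 4 * w \<alpha> \<beta> a \<le> K b + 4 * w \<alpha> \<beta> b"
proof (rule DERIV_nonneg_imp_nondecreasing[OF \<open>a \<le> b\<close>])
  fix t
  have "((\<lambda>t. K t + 4 * w \<alpha> \<beta> t) has_real_derivative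
      (\<kappa> t)\<^sup>2 * \<sigma> t + 4 * (\<sigma> t * ((n \<alpha> \<beta> t)\<^sup>2 + \<kappa> t * n \<alpha> \<beta> t))) (at t)"
    by (intro DERIV_add K DERIV_cmult w_deriv nz)
  moreover have "(\<kappa> t)\<^sup>2 * \<sigma> t + 4 * (\<sigma> t * ((n \<alpha> \<beta> t)\<^sup>2 + \<kappa> t * n \<alpha> \<beta> t))
      = \<sigma> t * (\<kappa> t + 2 * n \<alpha> \<beta> t)\<^sup>2"
    by (simp add: power2_eq_square algebra_simps)
  moreover have "\<dots> \<ge> 0" using speed_pos[of t] by simp
  ultimately show "\<exists>z. ((\<lambda>t. K t + 4 * w \<alpha> \<beta> t) has_real_derivative z) (at t) \<and> 0 \<le> z"
    by metis
qed

lemma w_bounds: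
  assumes "\<alpha> \<noteq> 0 \<or> \<beta> \<noteq> 0"
  shows "\<bar>w \<alpha> \<beta> t\<bar> \<le> 1"
proof -
  have "(w \<alpha> \<beta> t)\<^sup>2 \<le> 1"
    using n_w_squares[OF assms, of t] zero_le_power2[of "n \<alpha> \<beta> t"] by linarith
  then show ?thesis by (simp add: abs_square_le_1)
qed

lemma initial_pair:
  obtains \<alpha> \<beta> \<alpha>' \<beta>' where
    "\<alpha> \<noteq> 0 \<or> \<beta> \<noteq> 0" "D \<alpha> \<beta> a / y a = 1" "w \<alpha> \<beta> a = 1"
    "\<alpha>' \<noteq> 0 \<or> \<beta>' \<noteq> 0" "D \<alpha>' \<beta>' a / y a = 1" "w \<alpha>' \<beta>' a = -1"
proof -
  have u: "Im (\<i> * e a * cnj (e a)) = 1" "Im (- \<i> * e a * cnj (e a)) = - 1"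
    using e_squares[of a] by (simp_all add: power2_eq_square)
  obtain \<alpha> \<beta> where "\<alpha> \<noteq> 0 \<or> \<beta> \<noteq> 0" "D \<alpha> \<beta> a / y a = 1" "w \<alpha> \<beta> a = 1"
    using initial_direction[of "\<i> * e a" a] u(1) by (auto simp: norm_mult)
  moreover obtain \<alpha>' \<beta>' where "\<alpha>' \<noteq> 0 \<or> \<beta>' \<noteq> 0" "D \<alpha>' \<beta>' a / y a = 1" "w \<alpha>' \<beta>' a = -1"
    using initial_direction[of "- \<i> * e a" a] u(2) by (auto simp: norm_mult)
  ultimately show ?thesis using that by blast
qed

text \<open>With \<open>P\<close>, \<open>Q\<close> the parameters of the Busemann functions that are extremal at the base point \<open>a\<close> and
  \<open>v = w\<^sub>Q - w\<^sub>P\<close>: the energy before \<open>b\<close> pays for the decrease of \<open>w\<^sub>P\<close> from \<open>1\<close>, the energy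
  after \<open>b\<close> for the return of \<open>w\<^sub>Q\<close> to \<open>-1\<close>.\<close>

lemma energy_ge_difference:
  assumes K: "\<And>t. (K has_real_derivative (\<kappa> t)\<^sup>2 * \<sigma> t) (at t)"
    and KE: "\<And>t. K (t + 2 * pi) = K t + elastic_energy \<gamma>"
    and P: "\<alpha> \<noteq> 0 \<or> \<beta> \<noteq> 0" "w \<alpha> \<beta> a = 1" and Q: "\<alpha>' \<noteq> 0 \<or> \<beta>' \<noteq> 0" "w \<alpha>' \<beta>' a = -1"
    and b: "a \<le> b" "b \<le> a + 2 * pi"
  shows "elastic_energy \<gamma> \<ge> 8 + 4 * (w \<alpha>' \<beta>' b - w \<alpha> \<beta> b)"
  using energy_mono[OF K P(1) b(1)] energy_mono[OF K Q(1) b(2)] KE[of a] P(2) Q(2)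
  by (simp add: w_periodic)

lemma log_ratio_deriv:
  assumes "\<alpha> \<noteq> 0 \<or> \<beta> \<noteq> 0" "\<alpha>' \<noteq> 0 \<or> \<beta>' \<noteq> 0"
  shows "((\<lambda>t. ln (D \<alpha>' \<beta>' t / y t) - ln (D \<alpha> \<beta> t / y t)) has_real_derivative
      \<sigma> t * (w \<alpha>' \<beta>' t - w \<alpha> \<beta> t)) (at t)"
  using DERIV_diff[OF ln_height_deriv[OF assms(2)] ln_height_deriv[OF assms(1)]]
  by (simp add: right_diff_distrib)

text \<open>This also supplies the numerator of the lower bound for the quotient, where
  \<open>length_bound\<close> controls the denominator.\<close>

lemma energy_ge_8: "elastic_energy \<gamma> \<ge> 8"
proof (rule ccontr)
  assume E: "\<not> elastic_energy \<gamma> \<ge> 8"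
  obtain S K where K: "\<And>t. (K has_real_derivative (\<kappa> t)\<^sup>2 * \<sigma> t) (at t)"
    "\<And>t. K (t + 2 * pi) = K t + elastic_energy \<gamma>"
    using obtains_arclength_energy by metis
  obtain \<alpha> \<beta> \<alpha>' \<beta>' where
    P: "\<alpha> \<noteq> 0 \<or> \<beta> \<noteq> 0" "D \<alpha> \<beta> 0 / y 0 = 1" "w \<alpha> \<beta> 0 = 1" and
    Q: "\<alpha>' \<noteq> 0 \<or> \<beta>' \<noteq> 0" "D \<alpha>' \<beta>' 0 / y 0 = 1" "w \<alpha>' \<beta>' 0 = -1"
    using initial_pair[of 0] by metis
  define V where "V t = ln (D \<alpha>' \<beta>' t / y t) - ln (D \<alpha> \<beta> t / y t)" for t
  have "V (2 * pi) < V 0"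
  proof (rule DERIV_neg_imp_decreasing[of 0 "2 * pi" V])
    fix t :: real assume t: "0 \<le> t" "t \<le> 2 * pi"
    have "w \<alpha>' \<beta>' t - w \<alpha> \<beta> t < 0"
      using energy_ge_difference[OF K P(1,3) Q(1,3), of t] t E by simp
    then have "\<sigma> t * (w \<alpha>' \<beta>' t - w \<alpha> \<beta> t) < 0" using speed_pos[of t] by (simp add: mult_pos_neg)
    then show "\<exists>z. (V has_real_derivative z) (at t) \<and> z < 0"
      using log_ratio_deriv[OF P(1) Q(1), of t] unfolding V_def[abs_def] by blast
  qed simp
  then show False
    using height_periodic[of _ _ 0] by (simp add: V_def)
qed

lemma log_ratio_bound:
  assumes K: "\<And>t. (K has_real_derivative (\<kappa> t)\<^sup>2 * \<sigma> t) (at t)"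
    and KE: "\<And>t. K (t + 2 * pi) = K t + elastic_energy \<gamma>"
    and P: "\<alpha> \<noteq> 0 \<or> \<beta> \<noteq> 0" "D \<alpha> \<beta> a / y a = 1" "w \<alpha> \<beta> a = 1"
    and Q: "\<alpha>' \<noteq> 0 \<or> \<beta>' \<noteq> 0" "D \<alpha>' \<beta>' a / y a = 1" "w \<alpha>' \<beta>' a = -1"
    and d: "d > 0" "elastic_energy \<gamma> \<le> 16 - d"
    and b: "a \<le> b" "b \<le> a + 2 * pi"
  shows "- (ln (D \<alpha>' \<beta>' b / y b) - ln (D \<alpha> \<beta> b / y b)) \<le> 144 / d"
proof -
  define V where "V t = ln (D \<alpha>' \<beta>' t / y t) - ln (D \<alpha> \<beta> t / y t)" for t
  \<comment> \<open>The bracket grows at least at rate \<open>(p^2 + q^2) / 2\<close> per arclength,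
    and \<open>key\<close> bounds the rate of \<open>V\<close> by \<open>4 / d\<close> times
    \<open>p^2 + q^2\<close>; the factor \<open>8 / d\<close> makes the bracket win.\<close>
  let ?F = "\<lambda>t. (8 / d) * (w \<alpha> \<beta> t + w \<alpha>' \<beta>' t + K t) - V t"
  have "?F b \<le> ?F (a + 2 * pi)"
  proof (rule DERIV_nonneg_imp_nondecreasing[OF b(2)])
    fix t assume t: "b \<le> t" "t \<le> a + 2 * pi"
    define p q P1 Q1 where defs: "p = n \<alpha> \<beta> t" "q = n \<alpha>' \<beta>' t" "P1 = w \<alpha> \<beta> t" "Q1 = w \<alpha>' \<beta>' t"
    have v: "4 * (Q1 - P1) \<le> 8 - d"
      using energy_ge_difference[OF K KE P(1,3) Q(1,3), of t] t b d(2) by (simp add: defs)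
    have sq: "p\<^sup>2 = 1 - P1\<^sup>2" "q\<^sup>2 = 1 - Q1\<^sup>2"
      using n_w_squares[OF P(1), of t] n_w_squares[OF Q(1), of t] by (auto simp: defs)
    have bd: "P1 \<ge> -1" "Q1 \<le> 1" "P1 \<le> 1" "Q1 \<ge> -1"
      using w_bounds[OF P(1), of t] w_bounds[OF Q(1), of t] by (auto simp: defs)
    have key: "Q1 - P1 \<le> (4 / d) * (p\<^sup>2 + q\<^sup>2)"
    proof (cases "Q1 - P1 \<le> 0")
      case True
      moreover have "0 \<le> (4 / d) * (p\<^sup>2 + q\<^sup>2)" using d by simp
      ultimately show ?thesis by linarith
    next
      case False
      \<comment> \<open>The slack is \<open>2 * (1 - Q1) * (1 + P1)\<close>. The energy bound enters
        next, as \<open>2 - (Q1 - P1) \<ge> d / 4\<close>.\<close>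
      have "(Q1 - P1) * (2 - (Q1 - P1)) \<le> p\<^sup>2 + q\<^sup>2"
        using mult_nonneg_nonneg[of "1 - Q1" "P1 + 1"] bd
        unfolding sq by (simp add: power2_eq_square algebra_simps)
      moreover have "(Q1 - P1) * (d / 4) \<le> (Q1 - P1) * (2 - (Q1 - P1))"
        using False v by (intro mult_left_mono) auto
      ultimately have "(Q1 - P1) * (d / 4) \<le> p\<^sup>2 + q\<^sup>2" by linarith
      then show ?thesis using d(1) by (simp add: field_simps)
    qed
    let ?z = "(8 / d) * (\<sigma> t * (p\<^sup>2 + \<kappa> t * p) + \<sigma> t * (q\<^sup>2 + \<kappa> t * q) + (\<kappa> t)\<^sup>2 * \<sigma> t)
        - \<sigma> t * (Q1 - P1)"
    have "(?F has_real_derivative ?z) (at t)"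
      unfolding V_def defs
      by (intro DERIV_diff DERIV_cmult DERIV_add w_deriv K log_ratio_deriv P Q)
    moreover have "?z \<ge> 0"
    proof -
      have "(4 / d) * (p\<^sup>2 + q\<^sup>2) \<le> (8 / d) * (p\<^sup>2 + \<kappa> t * p + (q\<^sup>2 + \<kappa> t * q) + (\<kappa> t)\<^sup>2)"
      proof -
        \<comment> \<open>The difference of the two sides is
          \<open>(p + \<kappa>)^2 + (q + \<kappa>)^2\<close>.\<close>
        have "p\<^sup>2 + q\<^sup>2 \<le> 2 * (p\<^sup>2 + \<kappa> t * p + (q\<^sup>2 + \<kappa> t * q) + (\<kappa> t)\<^sup>2)"
          using zero_le_power2[of "p + \<kappa> t"] zero_le_power2[of "q + \<kappa> t"]
          by (simp add: power2_eq_square algebra_simps)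
        from mult_left_mono[OF this, of "4 / d"] show ?thesis using d(1) by simp
      qed
      then have "\<sigma> t * (Q1 - P1) \<le> \<sigma> t * ((8 / d) * (p\<^sup>2 + \<kappa> t * p + (q\<^sup>2 + \<kappa> t * q) + (\<kappa> t)\<^sup>2))"
        using key speed_pos[of t] by (intro mult_left_mono) auto
      then show ?thesis by (simp add: algebra_simps)
    qed
    ultimately show "\<exists>z. (?F has_real_derivative z) (at t) \<and> 0 \<le> z" by blast
  qed
  moreover have "V (a + 2 * pi) = 0"
    unfolding V_def height_periodic using P(2) Q(2) by simp
  moreover have "K (a + 2 * pi) = K a + elastic_energy \<gamma>" by (rule KE)
  moreover have "K a \<le> K b"
    by (rule DERIV_nonneg_imp_nondecreasing[OF b(1)])
      (use K speed_pos in \<open>force intro: less_imp_le mult_nonneg_nonneg\<close>)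
  ultimately have "- V b \<le> (8 / d) * (elastic_energy \<gamma> + K a) - (8 / d) * (w \<alpha> \<beta> b + w \<alpha>' \<beta>' b + K b)"
    using P(3) Q(3) by (simp add: w_periodic add.commute)
  also have "\<dots> = (8 / d) * (elastic_energy \<gamma> + K a - (w \<alpha> \<beta> b + w \<alpha>' \<beta>' b + K b))"
    by (simp add: right_diff_distrib)
  \<comment> \<open>18 = 16 + 2: the energy is at most 16 and the two values of \<open>w\<close> at
    \<open>b\<close> sum to at least -2, while at the end of the period they sum to 0. Hence 144 = 8
    * 18.\<close>
  also have "\<dots> \<le> (8 / d) * 18"
    using d w_bounds[OF P(1), of b] w_bounds[OF Q(1), of b] \<open>K a \<le> K b\<close>
    by (intro mult_left_mono) auto
  finally show ?thesis by (simp add: V_def)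
qed

text \<open>On a window of small energy the curve is so close to a geodesic that \<open>v \<le> -1\<close> throughout,
  and the logarithmic ratio drops by the hyperbolic length of the window.\<close>

lemma window_energy:
  assumes S: "\<And>t. (S has_real_derivative \<sigma> t) (at t)"
    and K: "\<And>t. (K has_real_derivative (\<kappa> t)\<^sup>2 * \<sigma> t) (at t)"
    and KE: "\<And>t. K (t + 2 * pi) = K t + elastic_energy \<gamma>"
    and d: "d > 0" "elastic_energy \<gamma> \<le> 16 - d"
    and b: "a \<le> b" "b \<le> a + 2 * pi"
    and \<tau>: "\<tau> = 144 / d + 1" "S b - S a = \<tau>"
  shows "exp (- 3 * \<tau>) \<le> K b - K a"
proof (rule ccontr)
  assume "\<not> ?thesis"
  then have small: "K b - K a < exp (- 3 * \<tau>)" by simp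
  have \<tau>1: "\<tau> \<ge> 1" using \<tau>(1) d by simp
  obtain \<alpha> \<beta> \<alpha>' \<beta>' where
    P: "\<alpha> \<noteq> 0 \<or> \<beta> \<noteq> 0" "D \<alpha> \<beta> a / y a = 1" "w \<alpha> \<beta> a = 1" and
    Q: "\<alpha>' \<noteq> 0 \<or> \<beta>' \<noteq> 0" "D \<alpha>' \<beta>' a / y a = 1" "w \<alpha>' \<beta>' a = -1"
    using initial_pair[of a] by metis
  have Kmono: "K s \<le> K t" if "s \<le> t" for s t
    by (rule DERIV_nonneg_imp_nondecreasing[OF that])
      (use K speed_pos in \<open>force intro: less_imp_le mult_nonneg_nonneg\<close>)
  have Smono: "S s \<le> S t" if "s \<le> t" for s t
    by (rule DERIV_nonneg_imp_nondecreasing[OF that])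
      (use S speed_pos in \<open>force intro: less_imp_le\<close>)
  have v: "w \<alpha>' \<beta>' t - w \<alpha> \<beta> t \<le> -1" if t: "a \<le> t" "t \<le> b" for t
  proof -
    have Kt: "K t - K a < exp (- 3 * \<tau>)" using small Kmono[OF t(2)] by linarith
    have "exp (- 3 * \<tau>) \<le> exp 0" using \<tau>1 by (subst exp_le_cancel_iff) simp
    then have "exp (- 3 * \<tau>) \<le> 1" by simp
    \<comment> \<open>The value 1 is attracting, so for \<open>w_P\<close> the monotonicity of
      \<open>K + 4 w\<close> is enough. The value -1 of \<open>w_Q\<close> is repelling, and the
      departure from it is bounded by a Gronwall argument, at an exponential price.\<close>
    then have "w \<alpha> \<beta> t \<ge> 1 / 2"
      using energy_mono[OF K P(1) t(1)] Kt P(3) by linarith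
    \<comment> \<open>Gronwall for \<open>1 + w_Q\<close>: its rate is at most
      \<open>3 * (1 + w_Q) + \<kappa>^2 / 2\<close>, with 2 from \<open>q^2\<close> and 1 from
      splitting \<open>\<kappa> * q\<close>. This is the 3 in
      \<open>exp (- 3 * \<tau>)\<close>.\<close>
    let ?z = "\<lambda>t. K t / 2 - (1 + w \<alpha>' \<beta>' t) * exp (- 3 * (S t - S a))"
    have "?z a \<le> ?z t"
    proof (rule DERIV_nonneg_imp_nondecreasing[OF t(1)])
      fix s assume s: "a \<le> s" "s \<le> t"
      define q Q1 E where defs: "q = n \<alpha>' \<beta>' s" "Q1 = w \<alpha>' \<beta>' s" "E = exp (- 3 * (S s - S a))"
      let ?d = "(\<kappa> s)\<^sup>2 * \<sigma> s / 2 - (\<sigma> s * (q\<^sup>2 + \<kappa> s * q) * E + E * (- 3 * \<sigma> s) * (1 + Q1))"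
      have "((\<lambda>t. 1 + w \<alpha>' \<beta>' t) has_real_derivative \<sigma> s * (q\<^sup>2 + \<kappa> s * q)) (at s)"
        using DERIV_add[OF DERIV_const w_deriv[OF Q(1), of s], of 1] by (simp add: defs)
      moreover have "((\<lambda>t. exp (- 3 * (S t - S a))) has_real_derivative E * (- 3 * \<sigma> s)) (at s)"
        unfolding defs by (auto intro!: derivative_eq_intros S)
      ultimately have "(?z has_real_derivative ?d) (at s)"
        unfolding defs by (intro DERIV_diff DERIV_cdivide K DERIV_mult)
      moreover have "?d \<ge> 0"
      proof -
        have q2: "q\<^sup>2 = 1 - Q1\<^sup>2" using n_w_squares[OF Q(1), of s] by (auto simp: defs)
        have E: "0 < E" "E \<le> 1" using Smono[OF s(1)] by (auto simp: defs)
        have "q\<^sup>2 \<le> 2 * (1 + Q1)"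
          using zero_le_power2[of "1 + Q1"] unfolding q2 by (simp add: power2_eq_square algebra_simps)
        moreover have "2 * (\<kappa> s * q) \<le> (\<kappa> s)\<^sup>2 + q\<^sup>2"
          using sum_squares_bound[of "\<kappa> s" q] by simp
        ultimately have "q\<^sup>2 + \<kappa> s * q - 3 * (1 + Q1) \<le> (\<kappa> s)\<^sup>2 / 2" by linarith
        then have "E * (q\<^sup>2 + \<kappa> s * q - 3 * (1 + Q1)) \<le> E * ((\<kappa> s)\<^sup>2 / 2)"
          using E by (intro mult_left_mono) auto
        also have "\<dots> \<le> 1 * ((\<kappa> s)\<^sup>2 / 2)" using E by (intro mult_right_mono) auto
        finally have "\<sigma> s * (E * (q\<^sup>2 + \<kappa> s * q - 3 * (1 + Q1))) \<le> \<sigma> s * ((\<kappa> s)\<^sup>2 / 2)"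
          using speed_pos[of s] by (intro mult_left_mono) auto
        then show ?thesis by (simp add: algebra_simps)
      qed
      ultimately show "\<exists>z. (?z has_real_derivative z) (at s) \<and> 0 \<le> z" by blast
    qed
    then have "(1 + w \<alpha>' \<beta>' t) * exp (- 3 * (S t - S a)) \<le> exp (- 3 * \<tau>) / 2"
      using Q(3) Kt by simp
    moreover have "exp (- 3 * \<tau>) \<le> exp (- 3 * (S t - S a))"
      using Smono[OF t(2)] \<tau>(2) by simp
    moreover have "1 + w \<alpha>' \<beta>' t \<ge> 0" using w_bounds[OF Q(1), of t] by auto
    ultimately have "(1 + w \<alpha>' \<beta>' t) * exp (- 3 * \<tau>) \<le> exp (- 3 * \<tau>) / 2"
      by (meson mult_left_mono order_trans)
    then have "1 + w \<alpha>' \<beta>' t \<le> 1 / 2" by simp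
    with \<open>w \<alpha> \<beta> t \<ge> 1 / 2\<close> show ?thesis by linarith
  qed
  define V where "V t = ln (D \<alpha>' \<beta>' t / y t) - ln (D \<alpha> \<beta> t / y t)" for t
  have "- V a - S a \<le> - V b - S b"
  proof (rule DERIV_nonneg_imp_nondecreasing[OF b(1)])
    fix t assume t: "a \<le> t" "t \<le> b"
    have "((\<lambda>t. - V t - S t) has_real_derivative - (\<sigma> t * (w \<alpha>' \<beta>' t - w \<alpha> \<beta> t)) - \<sigma> t) (at t)"
      unfolding V_def by (intro DERIV_diff DERIV_minus log_ratio_deriv P Q S)
    moreover have "\<sigma> t * (w \<alpha>' \<beta>' t - w \<alpha> \<beta> t) \<le> \<sigma> t * (-1)"
      using v[OF t] speed_pos[of t] by (intro mult_left_mono) auto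
    ultimately show "\<exists>z. ((\<lambda>t. - V t - S t) has_real_derivative z) (at t) \<and> 0 \<le> z"
      by (intro exI conjI) auto
  qed
  moreover have "V a = 0" unfolding V_def using P(2) Q(2) by simp
  ultimately have "\<tau> \<le> - V b" using \<tau>(2) by simp
  with log_ratio_bound[OF K KE P Q d b] show False by (simp add: V_def \<tau>(1))
qed

lemma length_pos: "hyp_length \<gamma> > 0"
proof -
  obtain S where S: "\<And>t. (S has_real_derivative \<sigma> t) (at t)"
    "\<And>t. S (t + 2 * pi) = S t + hyp_length \<gamma>"
    using obtains_arclength_energy by metis
  have "S 0 < S (0 + 2 * pi)"
    by (rule DERIV_pos_imp_increasing) (use S(1) speed_pos in auto)
  then show ?thesis by (simp only: S(2))
qed

lemma length_bound:
  assumes d: "d > 0" "elastic_energy \<gamma> \<le> 16 - d"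
  shows "hyp_length \<gamma> \<le> (144 / d + 1) * (16 / exp (- 3 * (144 / d + 1)) + 1)"
proof -
  obtain S K where
    S: "\<And>t. (S has_real_derivative \<sigma> t) (at t)" and
    K: "\<And>t. (K has_real_derivative (\<kappa> t)\<^sup>2 * \<sigma> t) (at t)" and
    SL: "\<And>t. S (t + 2 * pi) = S t + hyp_length \<gamma>" and
    KE: "\<And>t. K (t + 2 * pi) = K t + elastic_energy \<gamma>"
    using obtains_arclength_energy by metis
  define \<tau> where "\<tau> = 144 / d + 1"
  define \<eta> where "\<eta> = exp (- 3 * \<tau>)"
  have \<tau>1: "\<tau> \<ge> 1" using \<tau>_def d by simp
  have \<eta>0: "\<eta> > 0" by (simp add: \<eta>_def)
  have contS: "isCont S t" for t using S DERIV_isCont by blast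
  have ivt: "\<exists>s. 0 \<le> s \<and> s \<le> t \<and> S s = x" if "0 \<le> t" "S 0 \<le> x" "x \<le> S t" for t x
    using IVT[of S 0 x t] that contS by blast
  have windows: "\<forall>t. 0 \<le> t \<and> t \<le> 2 * pi \<and> S t - S 0 = real N * \<tau> \<longrightarrow> real N * \<eta> \<le> K t - K 0" for N
  proof (induction N)
    case 0
    have "K 0 \<le> K t" if "0 \<le> t" for t
      by (rule DERIV_nonneg_imp_nondecreasing[OF that])
        (use K speed_pos in \<open>force intro: less_imp_le mult_nonneg_nonneg\<close>)
    then show ?case by simp
  next
    case (Suc N)
    show ?case
    proof (intro allI impI)
      fix t assume t: "0 \<le> t \<and> t \<le> 2 * pi \<and> S t - S 0 = real (Suc N) * \<tau>"
      have "S 0 \<le> S 0 + real N * \<tau>" "S 0 + real N * \<tau> \<le> S t"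
        using t \<tau>1 by (auto simp: algebra_simps)
      then obtain s where s: "0 \<le> s" "s \<le> t" "S s = S 0 + real N * \<tau>"
        using ivt t by blast
      have "real N * \<eta> \<le> K s - K 0" using Suc.IH s t by auto
      moreover have "\<eta> \<le> K t - K s"
        unfolding \<eta>_def
        by (rule window_energy[OF S K KE d s(2) _ \<tau>_def]) (use s t in \<open>auto simp: algebra_simps\<close>)
      ultimately show "real (Suc N) * \<eta> \<le> K t - K 0" by (simp add: algebra_simps)
    qed
  qed
  \<comment> \<open>The number of complete windows in one period; the incomplete last one gives the
    summand 1 in the bound.\<close>
  define N where "N = nat \<lfloor>hyp_length \<gamma> / \<tau>\<rfloor>"
  have N: "real N \<le> hyp_length \<gamma> / \<tau>" "hyp_length \<gamma> / \<tau> \<le> real N + 1"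
    using length_pos \<tau>1 by (auto simp: N_def)
  have "real N * \<tau> \<le> hyp_length \<gamma>" using N(1) \<tau>1 by (simp add: field_simps)
  then obtain t where t: "0 \<le> t" "t \<le> 2 * pi" "S t = S 0 + real N * \<tau>"
    using ivt[of "2 * pi" "S 0 + real N * \<tau>"] SL[of 0] \<tau>1 by auto
  have "real N * \<eta> \<le> K t - K 0" using windows[of N] t by simp
  also have "\<dots> \<le> elastic_energy \<gamma>"
  proof -
    have "K t \<le> K (0 + 2 * pi)"
      by (rule DERIV_nonneg_imp_nondecreasing)
        (use t K speed_pos in \<open>force intro: less_imp_le mult_nonneg_nonneg\<close>)+
    then show ?thesis by (simp only: KE)
  qed
  finally have "real N * \<eta> \<le> 16" using d by simp
  then have "real N \<le> 16 / \<eta>" using \<eta>0 by (simp add: field_simps)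
  then have "hyp_length \<gamma> / \<tau> \<le> 16 / \<eta> + 1" using N by linarith
  then have "hyp_length \<gamma> \<le> \<tau> * (16 / \<eta> + 1)" using \<tau>1 by (simp add: field_simps)
  then show ?thesis by (simp add: \<tau>_def \<eta>_def)
qed

end

lemma quotient_bounded_below:
  assumes "\<delta> > 0"
  shows "\<exists>c>0. \<forall>\<gamma>. smooth_closed_curve \<gamma> \<and> immersed \<gamma> \<and> elastic_energy \<gamma> \<le> 16 - \<delta>
    \<longrightarrow> c \<le> elastic_energy \<gamma> / hyp_length \<gamma>"
proof -
  define L where "L = (144 / \<delta> + 1) * (16 / exp (- 3 * (144 / \<delta> + 1)) + 1)"
  have L: "L > 0" unfolding L_def using assms by (intro mult_pos_pos add_nonneg_pos) auto
  show ?thesis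
  proof (intro exI[of _ "8 / L"] conjI allI impI)
    fix \<gamma> assume h: "smooth_closed_curve \<gamma> \<and> immersed \<gamma> \<and> elastic_energy \<gamma> \<le> 16 - \<delta>"
    interpret closed_immersed_curve \<gamma> using h by unfold_locales auto
    show "8 / L \<le> elastic_energy \<gamma> / hyp_length \<gamma>"
      using length_bound[OF assms] h energy_ge_8 length_pos
      by (intro frac_le) (auto simp: L_def)
  qed (use L in simp)
qed


subsection \<open>Smooth functions and a cutoff\<close>

text \<open>\<open>Ck n\<close> is \<open>n\<close>-fold differentiability. Level 0 is vacuous, so
  inductions start trivially, and smoothness is \<open>Ck n\<close> for every
  \<open>n\<close>.\<close>

primrec Ck :: "nat \<Rightarrow> (real \<Rightarrow> real) \<Rightarrow> bool" where
  "Ck 0 f \<longleftrightarrow> True"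
| "Ck (Suc n) f \<longleftrightarrow> (\<forall>t. (f has_real_derivative deriv f t) (at t)) \<and> Ck n (deriv f)"

lemma Ck_SucI:
  assumes "\<And>t. (f has_real_derivative f' t) (at t)" "Ck n f'"
  shows "Ck (Suc n) f"
proof -
  have "deriv f = f'" using assms(1) by (simp add: fun_eq_iff DERIV_imp_deriv)
  with assms show ?thesis by simp
qed

lemma Ck_SucD: "Ck (Suc n) f \<Longrightarrow> Ck n f"
  by (induction n arbitrary: f) auto

lemma Ck_const: "Ck n (\<lambda>t. a)"
proof (induction n arbitrary: a)
  case (Suc n)
  show ?case by (rule Ck_SucI[where f' = "\<lambda>t. 0"]) (auto intro: Suc)
qed simp

lemma Ck_ident: "Ck n (\<lambda>t. t)"
proof (cases n)
  case (Suc m)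
  show ?thesis unfolding Suc by (rule Ck_SucI[where f' = "\<lambda>t. 1"]) (auto intro: Ck_const)
qed simp

lemma Ck_add: "Ck n f \<Longrightarrow> Ck n g \<Longrightarrow> Ck n (\<lambda>t. f t + g t)"
proof (induction n arbitrary: f g)
  case (Suc n)
  then show ?case
    by (intro Ck_SucI[where f' = "\<lambda>t. deriv f t + deriv g t"]) (auto intro: DERIV_add)
qed simp

lemma Ck_mult: "Ck n f \<Longrightarrow> Ck n g \<Longrightarrow> Ck n (\<lambda>t. f t * g t)"
proof (induction n arbitrary: f g)
  case (Suc n)
  have d: "Ck n (deriv f)" "Ck n (deriv g)" "Ck n f" "Ck n g"
    using Suc.prems Ck_SucD[OF Suc.prems(1)] Ck_SucD[OF Suc.prems(2)] by auto
  have "((\<lambda>t. f t * g t) has_real_derivative deriv f t * g t + deriv g t * f t) (at t)" for t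
    using Suc.prems by (intro DERIV_mult) auto
  then show ?case
    by (rule Ck_SucI) (intro Ck_add Suc.IH d)
qed simp

lemma Ck_minus: "Ck n f \<Longrightarrow> Ck n (\<lambda>t. - f t)"
  using Ck_mult[OF Ck_const[of n "-1"]] by simp

lemma Ck_diff: "Ck n f \<Longrightarrow> Ck n g \<Longrightarrow> Ck n (\<lambda>t. f t - g t)"
  using Ck_add[OF _ Ck_minus] by simp

lemma Ck_power: "Ck n f \<Longrightarrow> Ck n (\<lambda>t. f t ^ m)"
  by (induction m) (auto intro: Ck_const Ck_mult)

lemma Ck_compose: "Ck n f \<Longrightarrow> Ck n g \<Longrightarrow> Ck n (\<lambda>t. f (g t))"
proof (induction n arbitrary: f)
  case (Suc n)
  have d: "Ck n (deriv f)" "Ck n (deriv g)" "Ck n g"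
    using Suc.prems Ck_SucD[OF Suc.prems(2)] by auto
  have "((\<lambda>t. f (g t)) has_real_derivative deriv f (g t) * deriv g t) (at t)" for t
  proof (rule DERIV_chain2[where f = f and g = g])
    show "(f has_real_derivative deriv f (g t)) (at (g t))" using Suc.prems(1) unfolding Ck.simps by blast
    show "(g has_real_derivative deriv g t) (at t)" using Suc.prems(2) unfolding Ck.simps by blast
  qed
  then show ?case
    by (rule Ck_SucI[OF _ Ck_mult[OF Suc.IH[OF d(1,3)] d(2)]])
qed simp

text \<open>Covers reciprocals and square roots at once, which is why the curve below is written
  with \<open>powr\<close>.\<close>

lemma Ck_powr:
  assumes "\<And>t. f t > 0" "Ck n f"
  shows "Ck n (\<lambda>t. f t powr a)"
  using assms(2)
proof (induction n arbitrary: a)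
  case (Suc n)
  have "((\<lambda>t. f t powr a) has_real_derivative a * f t powr (a - 1) * deriv f t) (at t)" for t
    using DERIV_fun_powr[of f "deriv f t" t a] Suc.prems assms(1)[of t] by simp
  then show ?case
  proof (rule Ck_SucI)
    have "Ck n (deriv f)" using Suc.prems by simp
    then show "Ck n (\<lambda>t. a * f t powr (a - 1) * deriv f t)"
      by (intro Ck_mult Ck_const Suc.IH Ck_SucD[OF Suc.prems])
  qed
qed simp

lemma Ck_sin_cos: "Ck n sin \<and> Ck n cos"
proof (induction n)
  case (Suc n)
  have "Ck (Suc n) sin" by (rule Ck_SucI[OF DERIV_sin]) (use Suc in simp)
  moreover have "Ck (Suc n) cos" by (rule Ck_SucI[OF DERIV_cos]) (use Suc in \<open>auto intro: Ck_minus\<close>)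
  ultimately show ?case by blast
qed simp

lemma Ck_arsinh: "Ck n (arsinh :: real \<Rightarrow> real)"
proof (cases n)
  case (Suc m)
  have "(arsinh has_real_derivative (1 + x\<^sup>2) powr (- 1 / 2)) (at x)" for x :: real
    using arsinh_real_has_field_derivative[of x UNIV]
    by (simp add: powr_minus powr_half_sqrt inverse_eq_divide add.commute)
  then show ?thesis
    unfolding Suc
    by (rule Ck_SucI) (intro Ck_powr Ck_add Ck_const Ck_power Ck_ident, simp add: add_pos_nonneg)
qed simp

lemmas Ck_intros = Ck_const Ck_ident Ck_add Ck_mult Ck_minus Ck_diff Ck_power Ck_powr
  Ck_compose[OF Ck_sin_cos[THEN conjunct1]] Ck_compose[OF Ck_sin_cos[THEN conjunct2]]
  Ck_compose[OF Ck_arsinh]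

lemma has_vector_derivative_Complex:
  assumes "(f has_real_derivative f') (at t)" "(g has_real_derivative g') (at t)"
  shows "((\<lambda>t. Complex (f t) (g t)) has_vector_derivative Complex f' g') (at t)"
  unfolding Complex_eq
  by (intro has_vector_derivative_add has_vector_derivative_mult_right has_vector_derivative_of_real assms)

lemma smooth_Complex:
  assumes "\<And>n. Ck n f" "\<And>n. Ck n g"
  shows "(velocity ^^ n) (\<lambda>t. Complex (f t) (g t)) differentiable at t"
  using assms
proof (induction n arbitrary: f g)
  case 0
  have "((\<lambda>t. Complex (f t) (g t)) has_vector_derivative Complex (deriv f t) (deriv g t)) (at t)"
    using 0[of "Suc 0"] by (intro has_vector_derivative_Complex) auto
  then show ?case by (auto intro: differentiableI_vector)
next
  case (Suc n)
  have "((\<lambda>t. Complex (f t) (g t)) has_vector_derivative Complex (deriv f t) (deriv g t)) (at t)" for t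
    using Suc.prems[of "Suc 0"] by (intro has_vector_derivative_Complex) auto
  then have "velocity (\<lambda>t. Complex (f t) (g t)) = (\<lambda>t. Complex (deriv f t) (deriv g t))"
    by (simp add: fun_eq_iff vector_derivative_at)
  moreover have "Ck m (deriv f)" "Ck m (deriv g)" for m
    using Suc.prems[of "Suc m"] by auto
  ultimately show ?case
    using Suc.IH by (simp only: funpow_Suc_right comp_apply)
qed

section \<open>A smooth step function\<close>

text \<open>\<open>exp (- 1 / v)\<close> continued by 0, together with powers of
  \<open>1 / v\<close>: the linear span of this family is closed under differentiation.\<close>

definition flat :: "nat \<Rightarrow> real \<Rightarrow> real" where
  "flat m v = (if v > 0 then exp (- (1 / v)) * (1 / v) ^ m else 0)"

lemma flat_deriv: "(flat m has_real_derivative flat (m + 2) v - real m * flat (m + 1) v) (at v)"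
proof -
  consider "v > 0" | "v < 0" | "v = 0" by linarith
  then show ?thesis
  proof cases
    case 1
    have "((\<lambda>v. exp (- (1 / v)) * (1 / v) ^ m) has_real_derivative
        flat (m + 2) v - real m * flat (m + 1) v) (at v)"
    proof -
      have r: "((\<lambda>v. 1 / v) has_real_derivative - ((1 / v)\<^sup>2)) (at v)"
        using 1 by (auto intro!: derivative_eq_intros simp: power2_eq_square)
      have "((\<lambda>v. (1 / v) ^ m) has_real_derivative - (real m * (1 / v) ^ (m + 1))) (at v)"
        by (rule DERIV_cong[OF DERIV_power[OF r, of m]]) (cases m; simp add: power2_eq_square)
      from DERIV_mult[OF DERIV_chain2[OF DERIV_exp DERIV_minus[OF r]] this]
      show ?thesis
        by (rule DERIV_cong) (use 1 in \<open>simp add: flat_def power2_eq_square algebra_simps\<close>)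
    qed
    then show ?thesis
      by (rule has_field_derivative_transform_within_open[of _ _ _ "{0<..}"]) (use 1 in \<open>auto simp: flat_def\<close>)
  next
    case 2
    have "((\<lambda>v. 0) has_real_derivative flat (m + 2) v - real m * flat (m + 1) v) (at v)"
      using 2 by (auto simp: flat_def)
    then show ?thesis
      by (rule has_field_derivative_transform_within_open[of _ _ _ "{..<0}"]) (use 2 in \<open>auto simp: flat_def\<close>)
  next
    case 3
    have "((\<lambda>h. flat m h / h) \<longlongrightarrow> 0) (at 0)"
    proof (rule filterlim_split_at)
      show "((\<lambda>h. flat m h / h) \<longlongrightarrow> 0) (at_left 0)"
        by (rule tendsto_eventually)
          (auto simp: eventually_at_left_field flat_def intro: exI[of _ "-1"])
      have "((\<lambda>h. inverse h ^ (m + 1) / exp (inverse h)) \<longlongrightarrow> (0::real)) (at_right 0)"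
        by (rule filterlim_compose[OF tendsto_power_div_exp_0 filterlim_inverse_at_top_right])
      then show "((\<lambda>h. flat m h / h) \<longlongrightarrow> 0) (at_right 0)"
        by (rule Lim_transform_eventually)
          (auto simp: eventually_at_right_field flat_def exp_minus field_simps intro!: exI[of _ 1])
    qed
    then show ?thesis
      unfolding 3 DERIV_def by (simp add: flat_def)
  qed
qed

lemma Ck_flat: "Ck n (flat m)"
proof (induction n arbitrary: m)
  case (Suc n)
  show ?case
    by (rule Ck_SucI[OF flat_deriv]) (intro Ck_diff Ck_mult Ck_const Suc)
qed simp

text \<open>\<open>v \<mapsto> exp 1 * flat 0 v\<close> vanishes for \<open>v \<le> 0\<close>, equals \<open>1\<close> at \<open>1\<close> and is at least \<open>1\<close> beyond; composing it
  with its own reflection gives a smooth step that is constant outside \<open>[0, 1]\<close>.\<close>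

definition step :: "real \<Rightarrow> real" where
  "step u = exp 1 * flat 0 (1 - exp 1 * flat 0 (1 - u))"

lemma Ck_step: "Ck n step"
  unfolding step_def[abs_def]
  by (intro Ck_mult Ck_const Ck_compose[OF Ck_flat] Ck_diff Ck_ident)

lemma step_eq_0: "u \<le> 0 \<Longrightarrow> step u = 0"
proof -
  assume u: "u \<le> 0"
  have "1 / (1 - u) \<le> 1" using u by simp
  then have "exp 1 * flat 0 (1 - u) \<ge> 1"
    using u by (simp add: flat_def flip: exp_add)
  then show ?thesis by (simp add: step_def flat_def)
qed

lemma step_eq_1: "u \<ge> 1 \<Longrightarrow> step u = 1"
  by (simp add: step_def flat_def flip: exp_add)

lemma step_deriv: "(step has_real_derivative deriv step u) (at u)"
  "(deriv step has_real_derivative deriv (deriv step) u) (at u)"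
  using Ck_step[of "Suc (Suc 0)"] by auto

lemma deriv_locally_const:
  assumes "open T" "u \<in> T" "\<And>x. x \<in> T \<Longrightarrow> f x = a"
  shows "deriv f u = (0::real)"
proof -
  have "(f has_real_derivative 0) (at u)"
    by (rule has_field_derivative_transform_within_open[OF DERIV_const assms(1,2)])
      (use assms(3) in simp)
  then show ?thesis by (rule DERIV_imp_deriv)
qed

lemma deriv_step_eq_0:
  assumes "u < 0 \<or> u > 1"
  shows "deriv step u = 0" "deriv (deriv step) u = 0"
proof -
  have *: "deriv step x = 0" if "x < 0 \<or> x > 1" for x
    using that
  proof
    assume "x < 0"
    then show ?thesis
      by (intro deriv_locally_const[of "{..<0}" x step 0]) (auto simp: step_eq_0)
  next
    assume "x > 1"
    then show ?thesis
      by (intro deriv_locally_const[of "{1<..}" x step 1]) (auto simp: step_eq_1)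
  qed
  from assms show "deriv step u = 0" by (rule *)
  show "deriv (deriv step) u = 0"
    using assms by (intro deriv_locally_const[of "{..<0} \<union> {1<..}"]) (auto simp: *)
qed

lemma step_bounds:
  obtains B where "B \<ge> 1" "\<And>u. \<bar>step u\<bar> \<le> B" "\<And>u. \<bar>deriv step u\<bar> \<le> B"
    "\<And>u. \<bar>deriv (deriv step) u\<bar> \<le> B"
proof -
  have bd: "\<exists>B. \<forall>u\<in>{0..1}. \<bar>f u\<bar> \<le> B" if "\<And>u. (f has_real_derivative f' u) (at u)"
    for f f' :: "real \<Rightarrow> real"
  proof -
    have "continuous_on {0..1} f"
      using that by (meson DERIV_continuous_on has_field_derivative_at_within)
    then have "bounded (f ` {0..1})" by (intro compact_imp_bounded compact_continuous_image) auto
    then show ?thesis by (auto simp: bounded_iff)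
  qed
  have d3: "(deriv (deriv step) has_real_derivative deriv (deriv (deriv step)) u) (at u)" for u
    using Ck_step[of "Suc (Suc (Suc 0))"] by auto
  obtain B0 B1 B2 where B: "\<forall>u\<in>{0..1}. \<bar>step u\<bar> \<le> B0" "\<forall>u\<in>{0..1}. \<bar>deriv step u\<bar> \<le> B1"
    "\<forall>u\<in>{0..1}. \<bar>deriv (deriv step) u\<bar> \<le> B2"
    using bd[OF step_deriv(1)] bd[OF step_deriv(2)] bd[OF d3] by metis
  define B where "B = Max {1, B0, B1, B2}"
  have ge: "1 \<le> B" "B0 \<le> B" "B1 \<le> B" "B2 \<le> B" by (auto simp: B_def)
  show ?thesis
  proof (rule that[of B])
    show "\<bar>step u\<bar> \<le> B" for u
      using order_trans[OF bspec[OF B(1)] ge(2), of u] step_eq_0[of u] step_eq_1[of u] ge(1)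
      by (cases "u < 0"; cases "u > 1") auto
    show "\<bar>deriv step u\<bar> \<le> B" for u
      using order_trans[OF bspec[OF B(2)] ge(3), of u] deriv_step_eq_0(1)[of u] ge(1)
      by (cases "u < 0"; cases "u > 1") auto
    show "\<bar>deriv (deriv step) u\<bar> \<le> B" for u
      using order_trans[OF bspec[OF B(3)] ge(4), of u] deriv_step_eq_0(2)[of u] ge(1)
      by (cases "u < 0"; cases "u > 1") auto
  qed (rule ge)
qed


section \<open>The catenary with its ends bent onto the imaginary axis\<close>

text \<open>\<open>cutoff1\<close> and \<open>cutoff2\<close> are the first two derivatives of the cut off identity function.\<close>

definition cutoff :: "real \<Rightarrow> real \<Rightarrow> real" where
  "cutoff M s = s * (step (M + 1 - s) * step (M + 1 + s))"

definition cutoff1 :: "real \<Rightarrow> real \<Rightarrow> real" where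
  "cutoff1 M s = step (M + 1 - s) * step (M + 1 + s)
     + s * (step (M + 1 - s) * deriv step (M + 1 + s) - deriv step (M + 1 - s) * step (M + 1 + s))"

definition cutoff2 :: "real \<Rightarrow> real \<Rightarrow> real" where
  "cutoff2 M s = 2 * (step (M + 1 - s) * deriv step (M + 1 + s) - deriv step (M + 1 - s) * step (M + 1 + s))
     + s * (deriv (deriv step) (M + 1 - s) * step (M + 1 + s)
       - 2 * (deriv step (M + 1 - s) * deriv step (M + 1 + s))
       + step (M + 1 - s) * deriv (deriv step) (M + 1 + s))"

lemma cutoff_deriv: "(cutoff M has_real_derivative cutoff1 M s) (at s)"
proof -
  have m: "((\<lambda>s. step (M + 1 - s)) has_real_derivative - deriv step (M + 1 - s)) (at s)"
    and p: "((\<lambda>s. step (M + 1 + s)) has_real_derivative deriv step (M + 1 + s)) (at s)"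
    by (rule DERIV_cong[OF DERIV_chain2[where f = step, OF step_deriv(1)]],
        auto intro!: derivative_eq_intros)+
  show ?thesis
    unfolding cutoff_def[abs_def] cutoff1_def
    by (rule DERIV_cong[OF DERIV_mult[OF DERIV_ident DERIV_mult[OF m p]]]) (simp add: algebra_simps)
qed

lemma cutoff1_deriv: "(cutoff1 M has_real_derivative cutoff2 M s) (at s)"
proof -
  have m: "((\<lambda>s. step (M + 1 - s)) has_real_derivative - deriv step (M + 1 - s)) (at s)"
    and p: "((\<lambda>s. step (M + 1 + s)) has_real_derivative deriv step (M + 1 + s)) (at s)"
    by (rule DERIV_cong[OF DERIV_chain2[where f = step, OF step_deriv(1)]],
        auto intro!: derivative_eq_intros)+
  have m': "((\<lambda>s. deriv step (M + 1 - s)) has_real_derivative - deriv (deriv step) (M + 1 - s)) (at s)"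
    and p': "((\<lambda>s. deriv step (M + 1 + s)) has_real_derivative deriv (deriv step) (M + 1 + s)) (at s)"
    by (rule DERIV_cong[OF DERIV_chain2[where f = "deriv step", OF step_deriv(2)]],
        auto intro!: derivative_eq_intros)+
  show ?thesis
    unfolding cutoff1_def[abs_def] cutoff2_def
    by (rule DERIV_cong[OF DERIV_add[OF DERIV_mult[OF m p] DERIV_mult[OF DERIV_ident
          DERIV_diff[OF DERIV_mult[OF m p'] DERIV_mult[OF m' p]]]]]) (simp add: algebra_simps)
qed

lemma Ck_cutoff: "Ck n (cutoff M)"
  unfolding cutoff_def[abs_def]
  by (intro Ck_mult Ck_ident Ck_compose[OF Ck_step] Ck_add Ck_diff Ck_const)

lemma cutoff_minus: "cutoff M (- s) = - cutoff M s"
  by (simp add: cutoff_def mult.commute)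

lemma cutoff_eq_0: "\<bar>s\<bar> \<ge> M + 1 \<Longrightarrow> cutoff M s = 0"
  using step_eq_0[of "M + 1 - s"] step_eq_0[of "M + 1 + s"] by (auto simp: cutoff_def abs_if split: if_splits)

lemma cutoff_inside:
  assumes "\<bar>s\<bar> < M"
  shows "cutoff1 M s = 1" "cutoff2 M s = 0"
proof -
  have u: "M + 1 - s > 1" "M + 1 + s > 1" using assms by auto
  have "step (M + 1 - s) = 1" "step (M + 1 + s) = 1"
    using u by (auto intro!: step_eq_1)
  moreover have "deriv step (M + 1 - s) = 0" "deriv step (M + 1 + s) = 0"
    "deriv (deriv step) (M + 1 - s) = 0" "deriv (deriv step) (M + 1 + s) = 0"
    using deriv_step_eq_0[OF disjI2] u by blast+
  ultimately show "cutoff1 M s = 1" "cutoff2 M s = 0"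
    by (simp_all add: cutoff1_def cutoff2_def)
qed

text \<open>Uniform in \<open>M\<close>, since the two steps are translates of fixed functions, so
  that \<open>M\<close> can be chosen after \<open>C\<close>. The linear growth comes from the
  identity that is being cut off.\<close>

lemma cutoff_bounds:
  obtains C where "C > 0" "\<And>M s. \<bar>cutoff1 M s\<bar> \<le> C * (1 + \<bar>s\<bar>)" "\<And>M s. \<bar>cutoff2 M s\<bar> \<le> C * (1 + \<bar>s\<bar>)"
proof -
  obtain B where B: "B \<ge> 1" "\<And>u. \<bar>step u\<bar> \<le> B" "\<And>u. \<bar>deriv step u\<bar> \<le> B"
    "\<And>u. \<bar>deriv (deriv step) u\<bar> \<le> B"
    using step_bounds by blast
  have m: "\<bar>a * b\<bar> \<le> B * B" if "\<bar>a\<bar> \<le> B" "\<bar>b\<bar> \<le> B" for a b :: real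
    using that B(1) by (simp add: abs_mult mult_mono)
  have ms: "\<bar>s * a\<bar> \<le> \<bar>s\<bar> * b" if "\<bar>a\<bar> \<le> b" for s a b :: real
    using that by (simp add: abs_mult mult_left_mono)
  have BB: "0 < B * B" using B(1) by simp
  show ?thesis
  proof (rule that[of "4 * (B * B)"])
    fix M s
    have 1: "\<bar>step (M + 1 - s) * deriv step (M + 1 + s) - deriv step (M + 1 - s) * step (M + 1 + s)\<bar>
        \<le> 2 * (B * B)"
      using m[OF B(2) B(3), of "M + 1 - s" "M + 1 + s"] m[OF B(3) B(2), of "M + 1 - s" "M + 1 + s"]
      by linarith
    have 2: "\<bar>deriv (deriv step) (M + 1 - s) * step (M + 1 + s)
       - 2 * (deriv step (M + 1 - s) * deriv step (M + 1 + s))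
       + step (M + 1 - s) * deriv (deriv step) (M + 1 + s)\<bar> \<le> 4 * (B * B)"
      using m[OF B(4) B(2), of "M + 1 - s" "M + 1 + s"] m[OF B(3) B(3), of "M + 1 - s" "M + 1 + s"]
        m[OF B(2) B(4), of "M + 1 - s" "M + 1 + s"]
      by linarith
    have nn: "0 \<le> \<bar>s\<bar> * (B * B)" using BB by simp
    show "\<bar>cutoff1 M s\<bar> \<le> 4 * (B * B) * (1 + \<bar>s\<bar>)"
      using ms[OF 1, of s] m[OF B(2) B(2), of "M + 1 - s" "M + 1 + s"] nn BB
      unfolding cutoff1_def by (simp add: algebra_simps)
    show "\<bar>cutoff2 M s\<bar> \<le> 4 * (B * B) * (1 + \<bar>s\<bar>)"
      using ms[OF 2, of s] 1 nn BB
      unfolding cutoff2_def by (simp add: algebra_simps)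
  qed (use BB in simp)
qed

text \<open>For the curve \<open>s \<mapsto> c (cutoff M s + \<i> cosh s)\<close> these are the hyperbolic speed and the product
  of curvature and speed; without the cutoff it is the unit speed hyperbolic catenary.\<close>

definition model_speed :: "real \<Rightarrow> real \<Rightarrow> real" where
  "model_speed M s = sqrt ((cutoff1 M s)\<^sup>2 + (sinh s)\<^sup>2) / cosh s"

definition model_turning :: "real \<Rightarrow> real \<Rightarrow> real" where
  "model_turning M s = (cutoff1 M s * cosh s - cutoff2 M s * sinh s) / ((cutoff1 M s)\<^sup>2 + (sinh s)\<^sup>2)
     + cutoff1 M s / cosh s"

text \<open>The exact catenary has density \<open>4 / cosh^2\<close>. Beyond \<open>M\<close> the
  cutoff terms grow linearly against the exponential \<open>sinh\<close>: the curve is nearly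
  vertical there, and bending it is cheap. The error is measured by
  \<open>\<epsilon> / (1 + s^2)\<close> because this has the bounded antiderivative
  \<open>\<epsilon> * arctan s\<close>.\<close>

lemma model_energy_density:
  assumes "\<epsilon> > 0"
  obtains M where "M \<ge> 1"
    "\<And>s. (model_turning M s)\<^sup>2 / model_speed M s \<le> 4 / (cosh s)\<^sup>2 + \<epsilon> / (1 + s\<^sup>2)"
proof -
  obtain C where C: "C > 0" "\<And>M s. \<bar>cutoff1 M s\<bar> \<le> C * (1 + \<bar>s\<bar>)" "\<And>M s. \<bar>cutoff2 M s\<bar> \<le> C * (1 + \<bar>s\<bar>)"
    using cutoff_bounds by blast
  \<comment> \<open>32 anticipates the square of the turning bound \<open>4 * A / \<sigma>\<close>
    divided by the speed bound 1/2, with \<open>A = C * (1 + x)\<close>.\<close>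
  have "((\<lambda>s::real. 32 * C\<^sup>2 * (1 + s)\<^sup>2 * (1 + s\<^sup>2) / (sinh s)\<^sup>2) \<longlongrightarrow> 0) at_top"
    unfolding sinh_field_def by real_asymp
  then have "\<forall>\<^sub>F s in at_top. 32 * C\<^sup>2 * (1 + s)\<^sup>2 * (1 + s\<^sup>2) / (sinh s)\<^sup>2 < \<epsilon>"
    using assms by (rule order_tendstoD)
  moreover have "filterlim (sinh :: real \<Rightarrow> real) at_top at_top"
    unfolding sinh_field_def by real_asymp
  then have "\<forall>\<^sub>F s :: real in at_top. sinh s \<ge> 1"
    by (simp add: filterlim_at_top)
  ultimately have "\<forall>\<^sub>F s :: real in at_top. 32 * C\<^sup>2 * (1 + s)\<^sup>2 * (1 + s\<^sup>2) / (sinh s)\<^sup>2 < \<epsilon> \<and> sinh s \<ge> 1"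
    by eventually_elim auto
  then obtain M0 where M0: "\<And>s :: real. s \<ge> M0 \<Longrightarrow>
      32 * C\<^sup>2 * (1 + s)\<^sup>2 * (1 + s\<^sup>2) / (sinh s)\<^sup>2 < \<epsilon> \<and> sinh s \<ge> 1"
    by (auto simp: eventually_at_top_linorder)
  define M where "M = max 1 M0"
  show ?thesis
  proof (rule that[of M])
    fix s
    show "(model_turning M s)\<^sup>2 / model_speed M s \<le> 4 / (cosh s)\<^sup>2 + \<epsilon> / (1 + s\<^sup>2)"
    proof (cases "\<bar>s\<bar> < M")
      case True
      have ch: "1 + (sinh s)\<^sup>2 = (cosh s)\<^sup>2" by (simp add: cosh_square_eq)
      have "model_speed M s = 1"
        by (simp add: model_speed_def cutoff_inside[OF True] ch)
      moreover have "cosh s / (cosh s)\<^sup>2 = 1 / cosh s" by (simp add: power2_eq_square)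
      then have "model_turning M s = 2 / cosh s"
        by (simp add: model_turning_def cutoff_inside[OF True] ch)
      moreover have "0 \<le> \<epsilon> / (1 + s\<^sup>2)" using assms by (simp add: add_nonneg_nonneg)
      ultimately show ?thesis by (simp add: power_divide)
    next
      case False
      define x where "x = \<bar>s\<bar>"
      define \<sigma> where "\<sigma> = \<bar>sinh s\<bar>"
      define A where "A = C * (1 + x)"
      have sx: "\<sigma> = sinh x" by (cases "s \<ge> 0") (auto simp: \<sigma>_def x_def abs_if)
      have x: "x \<ge> M0" "x \<ge> 1" using False by (auto simp: x_def M_def)
      have \<sigma>1: "\<sigma> \<ge> 1" and small: "32 * C\<^sup>2 * (1 + x)\<^sup>2 * (1 + x\<^sup>2) / \<sigma>\<^sup>2 < \<epsilon>"
        using M0[OF x(1)] sx by auto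
      have A: "A > 0" "\<bar>cutoff1 M s\<bar> \<le> A" "\<bar>cutoff2 M s\<bar> \<le> A"
        using C x by (auto simp: A_def x_def)
      have c2: "(cosh s)\<^sup>2 = 1 + \<sigma>\<^sup>2" by (simp add: \<sigma>_def cosh_square_eq)
      have "1 \<le> \<sigma>\<^sup>2" using \<sigma>1 by simp
      then have "(cosh s)\<^sup>2 \<le> (2 * \<sigma>)\<^sup>2" unfolding c2 by (simp add: power_mult_distrib)
      then have ch2: "cosh s \<le> 2 * \<sigma>" by (rule power2_le_imp_le) (use \<sigma>1 in simp)
      have "\<sigma>\<^sup>2 \<le> (cosh s)\<^sup>2" unfolding c2 by simp
      then have ch1: "\<sigma> \<le> cosh s" by (rule power2_le_imp_le) simp
      have den: "\<sigma>\<^sup>2 \<le> (cutoff1 M s)\<^sup>2 + (sinh s)\<^sup>2" by (simp add: \<sigma>_def)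
      have "\<bar>cutoff1 M s * cosh s - cutoff2 M s * sinh s\<bar> \<le> A * (2 * \<sigma>) + A * \<sigma>"
      proof -
        have "\<bar>cutoff1 M s * cosh s\<bar> \<le> A * (2 * \<sigma>)"
          using A ch2 by (simp add: abs_mult mult_mono)
        moreover have "\<bar>cutoff2 M s * sinh s\<bar> \<le> A * \<sigma>"
          using A by (simp add: abs_mult \<sigma>_def mult_right_mono)
        ultimately show ?thesis by linarith
      qed
      then have "\<bar>cutoff1 M s * cosh s - cutoff2 M s * sinh s\<bar> / ((cutoff1 M s)\<^sup>2 + (sinh s)\<^sup>2)
          \<le> (A * (2 * \<sigma>) + A * \<sigma>) / \<sigma>\<^sup>2"
        using den \<sigma>1 A by (intro frac_le) auto
      moreover have "(A * (2 * \<sigma>) + A * \<sigma>) / \<sigma>\<^sup>2 = 3 * A / \<sigma>"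
        using \<sigma>1 by (simp add: power2_eq_square field_simps)
      moreover have "\<bar>cutoff1 M s / cosh s\<bar> \<le> A / \<sigma>"
        using A ch1 \<sigma>1 by (simp add: abs_divide frac_le)
      moreover have "\<bar>model_turning M s\<bar>
          \<le> \<bar>cutoff1 M s * cosh s - cutoff2 M s * sinh s\<bar> / ((cutoff1 M s)\<^sup>2 + (sinh s)\<^sup>2)
            + \<bar>cutoff1 M s / cosh s\<bar>"
      proof -
        have "\<bar>(cutoff1 M s)\<^sup>2 + (sinh s)\<^sup>2\<bar> = (cutoff1 M s)\<^sup>2 + (sinh s)\<^sup>2" by simp
        then show ?thesis
          unfolding model_turning_def
          using abs_triangle_ineq[of "(cutoff1 M s * cosh s - cutoff2 M s * sinh s) / ((cutoff1 M s)\<^sup>2 + (sinh s)\<^sup>2)"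
              "cutoff1 M s / cosh s"]
          by (simp add: abs_divide)
      qed
      ultimately have turn: "\<bar>model_turning M s\<bar> \<le> 4 * A / \<sigma>" by simp
      have "\<sigma> \<le> sqrt ((cutoff1 M s)\<^sup>2 + (sinh s)\<^sup>2)"
        using den by (rule real_le_rsqrt)
      then have "\<sigma> / (2 * \<sigma>) \<le> model_speed M s"
        unfolding model_speed_def using ch2 \<sigma>1 by (intro frac_le) auto
      then have speed: "1 / 2 \<le> model_speed M s" using \<sigma>1 by simp
      have "(model_turning M s)\<^sup>2 \<le> (4 * A / \<sigma>)\<^sup>2"
        using power_mono[OF turn, of 2] by simp
      then have "(model_turning M s)\<^sup>2 / model_speed M s \<le> (4 * A / \<sigma>)\<^sup>2 / (1 / 2)"
        using speed by (intro frac_le) auto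
      also have "\<dots> = 32 * C\<^sup>2 * (1 + x)\<^sup>2 / \<sigma>\<^sup>2"
        by (simp add: A_def power_mult_distrib power_divide)
      also have "\<dots> \<le> \<epsilon> / (1 + s\<^sup>2)"
      proof -
        have "0 < 1 + x\<^sup>2" by (simp add: add_pos_nonneg)
        moreover have "s\<^sup>2 = x\<^sup>2" by (simp add: x_def)
        ultimately show ?thesis using small by (simp add: field_simps)
      qed
      also have "\<dots> \<le> 4 / (cosh s)\<^sup>2 + \<epsilon> / (1 + s\<^sup>2)" by simp
      finally show ?thesis .
    qed
  qed (simp add: M_def)
qed


subsection \<open>Two catenaries joined along a geodesic\<close>

lemma velocity_inversion:
  assumes d: "\<And>t. (\<gamma> has_vector_derivative velocity \<gamma> t) (at t)"
    and inv: "\<And>t. \<gamma> (t + p) * \<gamma> t = - 1"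
  shows "velocity \<gamma> (t + p) * (\<gamma> t)\<^sup>2 = velocity \<gamma> t"
proof -
  have "((\<lambda>t. \<gamma> (t + p) * \<gamma> t) has_vector_derivative
      \<gamma> (t + p) * velocity \<gamma> t + velocity \<gamma> (t + p) * \<gamma> t) (at t)"
    by (rule has_vector_derivative_mult[OF has_vector_derivative_shift_arg[OF d] d])
  moreover have "((\<lambda>t. \<gamma> (t + p) * \<gamma> t) has_vector_derivative 0) (at t)"
    unfolding inv by simp
  ultimately have eq: "\<gamma> (t + p) * velocity \<gamma> t + velocity \<gamma> (t + p) * \<gamma> t = 0"
    by (rule vector_derivative_unique_at)
  have "velocity \<gamma> (t + p) * (\<gamma> t)\<^sup>2
      = (\<gamma> (t + p) * velocity \<gamma> t + velocity \<gamma> (t + p) * \<gamma> t) * \<gamma> t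
        - (\<gamma> (t + p) * \<gamma> t) * velocity \<gamma> t"
    by (simp add: power2_eq_square algebra_simps)
  then show ?thesis unfolding eq inv by simp
qed

context closed_immersed_curve
begin

text \<open>The map \<open>z \<mapsto> - 1 / z\<close> is an orientation preserving isometry. In
  \<open>curvature_times_speed\<close> its derivative \<open>1 / z^2\<close> lowers the Euclidean
  turning rate by \<open>2 * Im u\<close>, and the metric term regains exactly this.\<close>

lemma inversion_invariance:
  assumes inv: "\<And>t. \<gamma> (t + p) * \<gamma> t = - 1"
  shows "\<sigma> (t + p) = \<sigma> t" "\<kappa> (t + p) = \<kappa> t"
proof -
  define z where "z = \<gamma> t"
  define u where "u = velocity \<gamma> t / z"
  have z0: "z \<noteq> 0" using inv[of t] by (auto simp: z_def)
  have g: "\<gamma> (t + p) = - 1 / z" using inv[of t] z0 by (simp add: z_def field_simps)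
  have v: "velocity \<gamma> (s + p) * (\<gamma> s)\<^sup>2 = velocity \<gamma> s" for s
    by (rule velocity_inversion[OF has_velocity inv])
  have vt: "velocity \<gamma> (t + p) = u / z"
    using v[of t] z0 by (simp add: u_def z_def field_simps power2_eq_square)
  have Im_g: "y (t + p) = y t / (norm z)\<^sup>2"
    unfolding g by (simp add: Im_divide z_def cmod_power2)
  show s: "\<sigma> (t + p) = \<sigma> t"
    unfolding speed_eq vt Im_g using z0 by (simp add: u_def norm_divide norm_mult power2_eq_square)
  let ?a = "\<lambda>t. vector_derivative (velocity \<gamma>) (at t)"
  have sq: "((\<lambda>s. (\<gamma> s)\<^sup>2) has_vector_derivative 2 * \<gamma> t * velocity \<gamma> t) (at t)"
    unfolding power2_eq_square
    by (rule has_vector_derivative_eq_rhs[OF has_vector_derivative_mult[OF has_velocity has_velocity]]) simp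
  have "((\<lambda>s. velocity \<gamma> (s + p) * (\<gamma> s)\<^sup>2) has_vector_derivative
      velocity \<gamma> (t + p) * (2 * \<gamma> t * velocity \<gamma> t) + ?a (t + p) * (\<gamma> t)\<^sup>2) (at t)"
    by (rule has_vector_derivative_mult[OF has_vector_derivative_shift_arg[OF has_acceleration] sq])
  then have "(velocity \<gamma> has_vector_derivative
      velocity \<gamma> (t + p) * (2 * \<gamma> t * velocity \<gamma> t) + ?a (t + p) * (\<gamma> t)\<^sup>2) (at t)"
    unfolding v .
  then have "?a t = velocity \<gamma> (t + p) * (2 * \<gamma> t * velocity \<gamma> t) + ?a (t + p) * (\<gamma> t)\<^sup>2"
    by (rule vector_derivative_at)
  then have "?a t / velocity \<gamma> t = 2 * u + ?a (t + p) / velocity \<gamma> (t + p)"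
    using z0 velocity_nonzero[of t]
    unfolding vt by (simp add: u_def z_def add_divide_distrib power2_eq_square)
  then have turn: "Im (?a (t + p) / velocity \<gamma> (t + p)) = Im (?a t / velocity \<gamma> t) - 2 * Im u"
    by simp
  have "Re (velocity \<gamma> (t + p)) / y (t + p) = Re (velocity \<gamma> t) / y t + 2 * Im u"
  proof -
    have "Re (u / z) * (norm z)\<^sup>2 = Re u * Re z + Im u * Im z"
      using z0 by (simp add: Re_divide cmod_power2 complex_eq_iff sum_power2_eq_zero_iff)
    moreover have "Re (velocity \<gamma> t) = Re u * Re z - Im u * Im z"
    proof -
      have "velocity \<gamma> t = u * z" using z0 by (simp add: u_def)
      then show ?thesis by simp
    qed
    moreover have "y t = Im z" by (simp add: z_def)
    ultimately show ?thesis
      unfolding vt Im_g using y_pos[of t] z0 by (simp add: field_simps)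
  qed
  then have "\<kappa> (t + p) * \<sigma> (t + p) = \<kappa> t * \<sigma> t"
    unfolding curvature_times_speed turn by simp
  then show "\<kappa> (t + p) = \<kappa> t"
    unfolding s using speed_pos[of t] by simp
qed

text \<open>The isometry exchanges the two halves of the period, so a bound is required only for
  \<open>|t| \<le> pi / 2\<close>, where the doubled catenary has its simple form.\<close>

lemma energy_le_of_half:
  assumes inv: "\<And>t. \<gamma> (t + pi) * \<gamma> t = - 1"
    and F: "\<And>t. \<bar>t\<bar> \<le> pi / 2 \<Longrightarrow> (F has_real_derivative f t) (at t)"
    and le: "\<And>t. \<bar>t\<bar> \<le> pi / 2 \<Longrightarrow> (\<kappa> t)\<^sup>2 * \<sigma> t \<le> f t"
  shows "elastic_energy \<gamma> \<le> 2 * (F (pi / 2) - F (- (pi / 2)))"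
proof -
  obtain S K where K: "\<And>t. (K has_real_derivative (\<kappa> t)\<^sup>2 * \<sigma> t) (at t)"
    "\<And>t. K (t + 2 * pi) = K t + elastic_energy \<gamma>"
    using obtains_arclength_energy by metis
  have "((\<lambda>t. K (t + pi) - K t) has_real_derivative 0) (at t)" for t
  proof -
    have "((\<lambda>t. K (t + pi)) has_real_derivative (\<kappa> (t + pi))\<^sup>2 * \<sigma> (t + pi)) (at t)"
      using K(1)[of "t + pi"] by (simp add: DERIV_shift)
    from DERIV_diff[OF this K(1)] show ?thesis
      by (simp add: inversion_invariance[OF inv])
  qed
  then have "K (pi / 2 + pi) - K (pi / 2) = K (- (pi / 2) + pi) - K (- (pi / 2))"
    by (intro DERIV_isconst_all) blast
  moreover have "pi / 2 + pi = - (pi / 2) + 2 * pi" "- (pi / 2) + pi = pi / 2" by simp_all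
  ultimately have E: "elastic_energy \<gamma> = 2 * (K (pi / 2) - K (- (pi / 2)))"
    using K(2)[of "- (pi / 2)"] by simp
  have "F (- (pi / 2)) - K (- (pi / 2)) \<le> F (pi / 2) - K (pi / 2)"
  proof (rule DERIV_nonneg_imp_nondecreasing[of "- (pi / 2)" "pi / 2" "\<lambda>t. F t - K t"])
    fix t assume "- (pi / 2) \<le> t" "t \<le> pi / 2"
    then have t: "\<bar>t\<bar> \<le> pi / 2" by auto
    show "\<exists>z. ((\<lambda>t. F t - K t) has_real_derivative z) (at t) \<and> 0 \<le> z"
      using DERIV_diff[OF F[OF t] K(1)] le[OF t] by (intro exI conjI) auto
  qed simp
  with E show ?thesis by simp
qed

text \<open>\<open>ln y\<close> is 1-Lipschitz for the hyperbolic distance.\<close>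

lemma length_ge_ln_ratio: "hyp_length \<gamma> \<ge> ln (y pi) - ln (y 0)"
proof -
  obtain S K where S: "\<And>t. (S has_real_derivative \<sigma> t) (at t)"
    "\<And>t. S (t + 2 * pi) = S t + hyp_length \<gamma>"
    using obtains_arclength_energy by metis
  have Smono: "S a \<le> S b" if "a \<le> b" for a b
    by (rule DERIV_nonneg_imp_nondecreasing[OF that])
      (use S(1) speed_pos in \<open>force intro: less_imp_le\<close>)
  have "S 0 - ln (y 0) \<le> S pi - ln (y pi)"
  proof (rule DERIV_nonneg_imp_nondecreasing[of 0 pi "\<lambda>t. S t - ln (y t)"])
    fix t
    have "((\<lambda>t. S t - ln (y t)) has_real_derivative \<sigma> t - 1 / y t * (\<sigma> t * y t * Im (e t))) (at t)"
      by (intro DERIV_diff S DERIV_chain2[OF DERIV_ln_divide[OF y_pos] has_derivative_y])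
    moreover have "Im (e t) \<le> 1" using abs_Im_le_cmod[of "e t"] by simp
    then have "\<sigma> t * Im (e t) \<le> \<sigma> t * 1" using speed_pos[of t] by (intro mult_left_mono) auto
    then have "0 \<le> \<sigma> t - 1 / y t * (\<sigma> t * y t * Im (e t))"
      using y_pos[of t] by simp
    ultimately show "\<exists>z. ((\<lambda>t. S t - ln (y t)) has_real_derivative z) (at t) \<and> 0 \<le> z" by blast
  qed simp
  moreover have "S pi \<le> S (0 + 2 * pi)" by (rule Smono) simp
  ultimately show ?thesis unfolding S(2) by simp
qed

end

section \<open>Construction of the doubled catenary\<close>

text \<open>For \<open>t\<close> near \<open>0\<close> the curve is \<open>c (cutoff M (S t) + \<i> cosh (S t))\<close>, for \<open>t\<close> near \<open>\<pi>\<close> its image under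
  \<open>z \<mapsto> - 1 / z\<close>; both parts run on the imaginary axis where they meet. The parametrisation \<open>S\<close> is
  chosen such that the height \<open>h t = c cosh (S t)\<close> satisfies \<open>h (t + \<pi>) = 1 / h t\<close>. The last factor of \<open>X\<close>
  compensates the sign change of \<open>S\<close> under \<open>t \<mapsto> t + 2 \<pi>\<close>, and the assumption \<open>far\<close> says that the
  cutoff is complete before the two parts meet.\<close>

locale doubled_catenary =
  fixes c M :: real
  assumes c: "0 < c" "c < 1" and M: "M \<ge> 1"
    and far: "sinh (M + 1) \<le> sqrt (1 - c ^ 4) / (2 * c)"
begin

text \<open>\<open>R\<close> has period \<open>2 * pi\<close>, so \<open>R (t + pi) / R t\<close> is
  inverted by a shift by \<open>pi\<close>. Its square root is the height \<open>h\<close>, equal to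
  \<open>c\<close> at 0 and to \<open>1 / c\<close> at \<open>pi\<close>.\<close>

definition R where "R t = (cos (t / 2))\<^sup>2 + c\<^sup>2 * (sin (t / 2))\<^sup>2"
text \<open>A smooth signed root of \<open>(h / c)^2 - 1\<close>, that is \<open>sinh (S t)\<close>;
  it rests on \<open>R (t + pi) - c^2 * R t = (1 - c^4) * sin^2 (t / 2)\<close>. The half angle lets
  it change sign at 0, at the price of the sign change over a period.\<close>

definition Q where "Q t = sqrt (1 - c ^ 4) / c * sin (t / 2) * R t powr (- 1 / 2)"
definition S where "S t = arsinh (Q t)"
definition h where "h t = c * (1 + (Q t)\<^sup>2) powr (1 / 2)"
definition X where "X t = cutoff M (S t) * (1 + (Q t)\<^sup>2) powr (- 1 / 2)
    * (step (2 * cos (t / 2)) - step (- 2 * cos (t / 2)))"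
text \<open>Where \<open>X (t + pi) = 0\<close> this is \<open>h * (X + \<i>)\<close>; where
  \<open>X t = 0\<close> it is \<open>- 1 / z\<close> for the point \<open>z\<close> that this
  formula gives at \<open>t + pi\<close>. One expression for both cases makes smoothness a closure
  property, without gluing.\<close>

definition curve where "curve t =
    Complex (h t * (X t - X (t + pi)) * (1 + (X (t + pi))\<^sup>2) powr - 1)
      (h t * (1 + (X (t + pi))\<^sup>2) powr - 1)"

lemma half_shift: "cos ((t + pi) / 2) = - sin (t / 2)" "sin ((t + pi) / 2) = cos (t / 2)"
  by (simp_all add: add_divide_distrib cos_add sin_add)

lemma c4: "0 < 1 - c ^ 4" "c\<^sup>2 < 1"
  using c by (simp_all add: power_less_one_iff)

lemma R_bounds: "0 < R t" "R t \<le> 1"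
proof -
  have cs: "(cos (t / 2))\<^sup>2 = 1 - (sin (t / 2))\<^sup>2" by (simp add: cos_squared_eq)
  have "R t = c\<^sup>2 + (1 - c\<^sup>2) * (cos (t / 2))\<^sup>2"
    unfolding R_def by (simp add: sin_squared_eq algebra_simps)
  moreover have "0 \<le> (1 - c\<^sup>2) * (cos (t / 2))\<^sup>2" "0 < c\<^sup>2" using c c4 by auto
  ultimately show "0 < R t" by linarith
  have "c\<^sup>2 * (sin (t / 2))\<^sup>2 \<le> 1 * (sin (t / 2))\<^sup>2"
    using c4 by (intro mult_right_mono) auto
  then show "R t \<le> 1" unfolding R_def cs by simp
qed

lemma Q_squared: "c\<^sup>2 * (1 + (Q t)\<^sup>2) = R (t + pi) / R t"
proof -
  have "(R t powr (- 1 / 2))\<^sup>2 = 1 / R t"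
    using R_bounds(1)[of t] by (simp add: powr_minus powr_half_sqrt power_inverse inverse_eq_divide power_divide)
  then have "(Q t)\<^sup>2 = (1 - c ^ 4) / c\<^sup>2 * (sin (t / 2))\<^sup>2 / R t"
    using c4 by (simp add: Q_def power_mult_distrib power_divide)
  then have "c\<^sup>2 * (1 + (Q t)\<^sup>2) = (c\<^sup>2 * R t + (1 - c ^ 4) * (sin (t / 2))\<^sup>2) / R t"
    using c R_bounds(1)[of t] by (simp add: field_simps)
  also have "c\<^sup>2 * R t + (1 - c ^ 4) * (sin (t / 2))\<^sup>2 = R (t + pi)"
    unfolding R_def half_shift by (simp add: algebra_simps power4_eq_xxxx power2_eq_square)
  finally show ?thesis .
qed

lemma Q_pos: "0 < 1 + (Q t)\<^sup>2"
  by (simp add: add_pos_nonneg)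

lemma h_eq: "h t = sqrt (R (t + pi) / R t)"
proof -
  have "h t = sqrt (c\<^sup>2) * sqrt (1 + (Q t)\<^sup>2)"
    using c Q_pos[of t] by (simp add: h_def powr_half_sqrt)
  also have "\<dots> = sqrt (R (t + pi) / R t)"
    by (simp only: Q_squared flip: real_sqrt_mult)
  finally show ?thesis .
qed

lemma h_pos: "0 < h t"
  unfolding h_eq using R_bounds(1)[of t] R_bounds(1)[of "t + pi"] by simp

lemma h_cosh: "h t = c * cosh (S t)"
  using Q_pos[of t] by (simp add: h_def S_def powr_half_sqrt cosh_arsinh_real add.commute)

lemma periodic: "R (t + 2 * pi) = R t" "Q (t + 2 * pi) = - Q t" "S (t + 2 * pi) = - S t"
  "h (t + 2 * pi) = h t" "X (t + 2 * pi) = X t"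
proof -
  have cs: "cos ((t + 2 * pi) / 2) = - cos (t / 2)" "sin ((t + 2 * pi) / 2) = - sin (t / 2)"
    by (simp_all add: add_divide_distrib)
  show R: "R (t + 2 * pi) = R t" by (simp add: R_def cs)
  show Q: "Q (t + 2 * pi) = - Q t" by (simp add: Q_def R cs)
  show S: "S (t + 2 * pi) = - S t" by (simp add: S_def Q arsinh_minus_real)
  show "h (t + 2 * pi) = h t" by (simp add: h_def Q)
  show "X (t + 2 * pi) = X t" 
    unfolding X_def Q S cs by (simp add: cutoff_minus algebra_simps)
qed

lemma h_shift: "h (t + pi) = 1 / h t"
proof -
  have "t + pi + pi = t + 2 * pi" by simp
  then have "R (t + pi + pi) = R t" by (simp only: periodic)
  then show ?thesis unfolding h_eq by (simp add: real_sqrt_divide)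
qed

text \<open>As \<open>R \<le> 1\<close>, here \<open>|Q t|\<close> is at least half of
  \<open>sqrt (1 - c ^ 4) / c\<close>; this is the 2 in \<open>far\<close>.\<close>

lemma X_eq_0:
  assumes "\<bar>sin (t / 2)\<bar> \<ge> 1 / 2"
  shows "X t = 0"
proof -
  have "R t powr (1 / 2) \<le> 1"
    using R_bounds[of t] by (simp add: powr_half_sqrt)
  then have "1 \<le> R t powr (- 1 / 2)"
    using R_bounds(1)[of t] by (simp add: powr_minus powr_half_sqrt one_le_inverse)
  then have "1 / 2 * 1 \<le> \<bar>sin (t / 2)\<bar> * R t powr (- 1 / 2)"
    using assms by (intro mult_mono) auto
  then have "sqrt (1 - c ^ 4) / c * (1 / 2) \<le> sqrt (1 - c ^ 4) / c * (\<bar>sin (t / 2)\<bar> * R t powr (- 1 / 2))"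
    using c c4 by (intro mult_left_mono) auto
  also have "\<dots> = \<bar>Q t\<bar>"
    using c c4 by (simp add: Q_def abs_mult)
  finally have "sinh (M + 1) \<le> \<bar>Q t\<bar>" using far by simp
  moreover have "sinh \<bar>S t\<bar> = \<bar>Q t\<bar>"
    by (cases "S t \<ge> 0") (auto simp: S_def abs_if)
  ultimately have "M + 1 \<le> \<bar>S t\<bar>"
    by (metis sinh_real_le_iff)
  then show ?thesis by (simp add: X_def cutoff_eq_0)
qed

lemma X_disjoint: "X t = 0 \<or> X (t + pi) = 0"
proof (rule ccontr)
  assume "\<not> ?thesis"
  then have "\<not> 1 / 2 \<le> \<bar>sin (t / 2)\<bar>" "\<not> 1 / 2 \<le> \<bar>cos (t / 2)\<bar>"
    using X_eq_0[of t] X_eq_0[of "t + pi"] unfolding half_shift by blast+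
  then have "\<bar>sin (t / 2)\<bar> < 1 / 2" "\<bar>cos (t / 2)\<bar> < 1 / 2"
    by linarith+
  then have "\<bar>sin (t / 2)\<bar>\<^sup>2 \<le> (1 / 2)\<^sup>2" "\<bar>cos (t / 2)\<bar>\<^sup>2 \<le> (1 / 2)\<^sup>2"
    by (intro power_mono; simp)+
  then show False using sin_cos_squared_add[of "t / 2"] by (simp add: power2_eq_square)
qed

lemma curve_inversion: "curve (t + pi) * curve t = - 1"
proof -
  have X2: "X (t + pi + pi) = X t"
    using periodic(5)[of t] by (simp add: add.assoc)
  have p: "0 < 1 + (X s)\<^sup>2" for s by (simp add: add_pos_nonneg)
  have h0: "h t \<noteq> 0" using h_pos[of t] by simp
  have *: "Complex (H * x) H * Complex (1 / H * - x * inverse (1 + x\<^sup>2)) (1 / H * inverse (1 + x\<^sup>2)) = - 1"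
    if "H \<noteq> 0" for H x :: real
  proof -
    have "0 < 1 + x\<^sup>2" by (simp add: add_pos_nonneg)
    then have "(1 + x\<^sup>2) * inverse (1 + x\<^sup>2) = 1" by simp
    then have "- (x * x * inverse (1 + x\<^sup>2)) - inverse (1 + x\<^sup>2) = - 1"
      by (simp add: algebra_simps power2_eq_square)
    then show ?thesis using that by (simp add: complex_eq_iff)
  qed
  have inv: "(1 + (X s)\<^sup>2) powr - 1 = inverse (1 + (X s)\<^sup>2)" for s
    using p[of s] by (simp add: powr_minus)
  consider "X t = 0" | "X (t + pi) = 0" using X_disjoint by blast
  then show ?thesis
  proof cases
    case 1
    then show ?thesis
      unfolding curve_def X2 h_shift inv using *[of "1 / h t" "X (t + pi)"] h0 by simp
  next
    case 2
    then show ?thesis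
      unfolding curve_def X2 h_shift inv using *[of "h t" "X t"] h0 by (simp add: mult.commute)
  qed
qed

lemma Ck_R: "Ck n R"
  unfolding R_def[abs_def] divide_inverse by (intro Ck_intros)

lemma Ck_Q: "Ck n Q"
  unfolding Q_def[abs_def] divide_inverse by (intro Ck_intros Ck_R R_bounds)

lemma Ck_S: "Ck n S"
  unfolding S_def[abs_def] by (intro Ck_intros Ck_Q)

lemma Ck_h: "Ck n h"
  unfolding h_def[abs_def] by (intro Ck_intros Ck_Q Q_pos)

lemma Ck_X: "Ck n X"
  unfolding X_def[abs_def] divide_inverse
  by (intro Ck_intros Ck_Q Q_pos Ck_compose[OF Ck_cutoff] Ck_compose[OF Ck_step] Ck_S)

lemma smooth_curve: "smooth_closed_curve curve"
  unfolding smooth_closed_curve_def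
proof (intro conjI allI)
  have p: "0 < 1 + (X s)\<^sup>2" for s by (simp add: add_pos_nonneg)
  show "curve t \<in> half_plane" for t
    using h_pos[of t] p[of "t + pi"] by (simp add: half_plane_def curve_def)
  have "X (t + 2 * pi + pi) = X (t + pi)" for t
    using periodic(5)[of "t + pi"] by (simp add: add_ac)
  then show "curve (t + 2 * pi) = curve t" for t
    by (simp add: curve_def periodic)
  show "(velocity ^^ n) curve differentiable at t" for n t
    unfolding curve_def[abs_def]
    by (rule smooth_Complex)
      (intro Ck_intros p Ck_h Ck_X Ck_compose[OF Ck_X])+
qed

section \<open>Local form, immersion, energy and length of the doubled catenary\<close>

text \<open>Up to \<open>2 * pi / 3\<close> one has \<open>cos (t / 2) > 1 / 2\<close>, which
  removes the inverted part and saturates the step factor. As \<open>2 * pi / 3 > pi / 2\<close>,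
  the translates of this interval by multiples of \<open>pi\<close> cover the line.\<close>

lemma bottom:
  assumes "\<bar>t\<bar> < 2 * pi / 3"
  shows "curve t = Complex (c * cutoff M (S t)) (c * cosh (S t))"
proof -
  have "cos (pi / 3) < cos \<bar>t / 2\<bar>"
    using assms by (intro cos_monotone_0_pi) auto
  moreover have "cos \<bar>t / 2\<bar> = cos (t / 2)" by (rule cos_abs_real)
  ultimately have ct: "cos (t / 2) > 1 / 2" by (simp add: cos_60)
  then have X2: "X (t + pi) = 0" by (intro X_eq_0) (simp add: half_shift)
  have "step (2 * cos (t / 2)) - step (- 2 * cos (t / 2)) = 1"
    using ct by (simp add: step_eq_0 step_eq_1)
  moreover have "(1 + (Q t)\<^sup>2) powr (1 / 2) * (1 + (Q t)\<^sup>2) powr (- 1 / 2) = 1"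
    using Q_pos[of t] by (simp flip: powr_add)
  ultimately have "h t * X t = c * cutoff M (S t)"
    by (simp add: h_def X_def algebra_simps)
  then show ?thesis
    unfolding curve_def X2 by (simp add: h_cosh)
qed

lemma S_deriv: "(S has_real_derivative deriv S t) (at t)"
  "(deriv S has_real_derivative deriv (deriv S) t) (at t)"
  using Ck_S[of "Suc (Suc 0)"] by auto

lemma S_deriv_pos:
  assumes "\<bar>t\<bar> < pi"
  shows "deriv S t > 0"
proof -
  let ?a = "sqrt (1 - c ^ 4) / c"
  have a: "?a > 0" using c c4 by simp
  have co: "cos (t / 2) > 0" using assms by (intro cos_gt_zero_pi) auto
  have R0: "R t > 0" by (rule R_bounds)
  have R': "(R has_real_derivative - ((1 - c\<^sup>2) * (cos (t / 2) * sin (t / 2)))) (at t)"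
    unfolding R_def[abs_def] by (auto intro!: derivative_eq_intros simp: power2_eq_square algebra_simps)
  have s': "((\<lambda>t. ?a * sin (t / 2)) has_real_derivative ?a * (cos (t / 2) / 2)) (at t)"
    using c by (auto intro!: derivative_eq_intros simp: mult.commute)
  have "(Q has_real_derivative ?a * (cos (t / 2) / 2) * R t powr (- 1 / 2)
      + - 1 / 2 * R t powr (- 1 / 2 - 1) * - ((1 - c\<^sup>2) * (cos (t / 2) * sin (t / 2)))
        * (?a * sin (t / 2))) (at t)"
    unfolding Q_def[abs_def] using DERIV_mult[OF s' DERIV_fun_powr[OF R' R0, of "- 1 / 2"]] by simp
  also have "?a * (cos (t / 2) / 2) * R t powr (- 1 / 2)
      + - 1 / 2 * R t powr (- 1 / 2 - 1) * - ((1 - c\<^sup>2) * (cos (t / 2) * sin (t / 2)))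
        * (?a * sin (t / 2))
      = ?a * cos (t / 2) / 2 * R t powr (- 1 / 2)
      + ?a * cos (t / 2) / 2 * (1 - c\<^sup>2) * (sin (t / 2))\<^sup>2 * R t powr (- 1 / 2 - 1)"
    by (simp add: power2_eq_square mult_ac)
  finally obtain d where d: "(Q has_real_derivative d) (at t)"
    and d_eq: "d = ?a * cos (t / 2) / 2 * R t powr (- 1 / 2)
      + ?a * cos (t / 2) / 2 * (1 - c\<^sup>2) * (sin (t / 2))\<^sup>2 * R t powr (- 1 / 2 - 1)"
    by blast
  note aco = half_gt_zero[OF mult_pos_pos[OF a co]]
  have "0 < ?a * cos (t / 2) / 2 * R t powr (- 1 / 2)"
    by (rule mult_pos_pos[OF aco]) (use R0 in simp)
  moreover have "0 \<le> ?a * cos (t / 2) / 2 * (1 - c\<^sup>2) * (sin (t / 2))\<^sup>2 * R t powr (- 1 / 2 - 1)"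
    by (intro mult_nonneg_nonneg less_imp_le[OF aco]) (use c4 in auto)
  ultimately have "d > 0" unfolding d_eq by linarith
  have "(S has_real_derivative 1 / sqrt ((Q t)\<^sup>2 + 1) * d) (at t)"
    unfolding S_def[abs_def] by (rule DERIV_chain2[OF arsinh_real_has_field_derivative d])
  then have "deriv S t = 1 / sqrt ((Q t)\<^sup>2 + 1) * d" by (rule DERIV_imp_deriv)
  moreover have "0 < (Q t)\<^sup>2 + 1" using Q_pos[of t] by simp
  ultimately show ?thesis using \<open>d > 0\<close> by simp
qed

lemma bottom_velocity:
  assumes "\<bar>t\<bar> < 2 * pi / 3"
  shows "velocity curve t = deriv S t *\<^sub>R Complex (c * cutoff1 M (S t)) (c * sinh (S t))"
proof -
  have "((\<lambda>t. c * cutoff M (S t)) has_real_derivative c * (cutoff1 M (S t) * deriv S t)) (at t)"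
    by (intro DERIV_cmult DERIV_chain2[OF cutoff_deriv S_deriv(1)])
  moreover have "((\<lambda>t. c * cosh (S t)) has_real_derivative c * (sinh (S t) * deriv S t)) (at t)"
    by (intro DERIV_cmult DERIV_chain2[where f = cosh, OF _ S_deriv(1)])
      (auto intro!: derivative_eq_intros)
  ultimately have "((\<lambda>t. Complex (c * cutoff M (S t)) (c * cosh (S t))) has_vector_derivative
      Complex (c * (cutoff1 M (S t) * deriv S t)) (c * (sinh (S t) * deriv S t))) (at t)"
    by (rule has_vector_derivative_Complex)
  then have "(curve has_vector_derivative
      Complex (c * (cutoff1 M (S t) * deriv S t)) (c * (sinh (S t) * deriv S t))) (at t)"
    by (rule has_vector_derivative_transform_within_open[of _ _ _ "{- (2 * pi / 3)<..<2 * pi / 3}"])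
      (use assms in \<open>auto simp: bottom\<close>)
  then show ?thesis
    by (simp add: vector_derivative_at complex_eq_iff)
qed

lemma bottom_acceleration:
  assumes "\<bar>t\<bar> < 2 * pi / 3"
  shows "vector_derivative (velocity curve) (at t) =
    (deriv S t)\<^sup>2 *\<^sub>R Complex (c * cutoff2 M (S t)) (c * cosh (S t))
    + deriv (deriv S) t *\<^sub>R Complex (c * cutoff1 M (S t)) (c * sinh (S t))"
proof -
  have "((\<lambda>t. c * cutoff1 M (S t)) has_real_derivative c * (cutoff2 M (S t) * deriv S t)) (at t)"
    by (intro DERIV_cmult DERIV_chain2[OF cutoff1_deriv S_deriv(1)])
  moreover have "((\<lambda>t. c * sinh (S t)) has_real_derivative c * (cosh (S t) * deriv S t)) (at t)"
    by (intro DERIV_cmult DERIV_chain2[where f = sinh, OF _ S_deriv(1)])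
      (auto intro!: derivative_eq_intros)
  ultimately have "((\<lambda>t. Complex (c * cutoff1 M (S t)) (c * sinh (S t))) has_vector_derivative
      Complex (c * (cutoff2 M (S t) * deriv S t)) (c * (cosh (S t) * deriv S t))) (at t)"
    by (rule has_vector_derivative_Complex)
  from has_vector_derivative_scaleR[OF S_deriv(2) this]
  have "(velocity curve has_vector_derivative
      deriv S t *\<^sub>R Complex (c * (cutoff2 M (S t) * deriv S t)) (c * (cosh (S t) * deriv S t))
      + deriv (deriv S) t *\<^sub>R Complex (c * cutoff1 M (S t)) (c * sinh (S t))) (at t)"
    by (rule has_vector_derivative_transform_within_open[of _ _ _ "{- (2 * pi / 3)<..<2 * pi / 3}"])
      (use assms in \<open>auto simp: bottom_velocity\<close>)
  then show ?thesis
    by (simp add: vector_derivative_at complex_eq_iff power2_eq_square)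
qed

lemma has_velocity_curve: "(curve has_vector_derivative velocity curve t) (at t)"
proof -
  have "curve differentiable at t"
    using smooth_curve unfolding smooth_closed_curve_def by (metis funpow_0)
  then show ?thesis by (simp add: vector_derivative_works)
qed

lemma immersed_curve: "immersed curve"
  unfolding immersed_def
proof
  have base: "velocity curve t \<noteq> 0" if t: "\<bar>t\<bar> < 2 * pi / 3" for t
  proof
    assume "velocity curve t = 0"
    moreover have "deriv S t > 0" using t pi_gt_zero by (intro S_deriv_pos) linarith
    ultimately have "cutoff1 M (S t) = 0" "sinh (S t) = 0"
      using c by (auto simp: bottom_velocity[OF t] complex_eq_iff)
    \<comment> \<open>The height is stationary only at \<open>S t = 0\<close>, well inside the uncut
      catenary, where the horizontal component does not vanish.\<close>
    then show False
      using cutoff_inside(1)[of "S t" M] M by simp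
  qed
  have shift: "velocity curve (t + pi) = 0 \<longleftrightarrow> velocity curve t = 0" for t
  proof -
    have "curve t \<noteq> 0" using curve_inversion[of t] by auto
    moreover have "velocity curve (t + pi) * (curve t)\<^sup>2 = velocity curve t"
      by (rule velocity_inversion[OF has_velocity_curve curve_inversion])
    ultimately show ?thesis by auto
  qed
  have shifts: "velocity curve (t + real n * pi) = 0 \<longleftrightarrow> velocity curve t = 0" for t n
  proof (induction n)
    case (Suc n)
    have "t + real (Suc n) * pi = t + real n * pi + pi" by (simp add: algebra_simps)
    then show ?case using Suc shift[of "t + real n * pi"] by (simp only:)
  qed simp
  fix t
  \<comment> \<open>Subtracting the nearest multiple of \<open>pi\<close> brings \<open>t\<close>
    into the range of \<open>bottom\<close>.\<close>
  define k where "k = round (t / pi)"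
  have "\<bar>of_int k - t / pi\<bar> \<le> 1 / 2"
    unfolding k_def by (rule of_int_round_abs_le)
  then have "\<bar>of_int k - t / pi\<bar> * pi \<le> 1 / 2 * pi" by (intro mult_right_mono) auto
  moreover have "\<bar>of_int k - t / pi\<bar> * pi = \<bar>(of_int k - t / pi) * pi\<bar>"
    by (simp add: abs_mult)
  moreover have "(of_int k - t / pi) * pi = of_int k * pi - t" by (simp add: left_diff_distrib)
  ultimately have "\<bar>t - of_int k * pi\<bar> * 2 \<le> pi"
    by (simp add: abs_minus_commute)
  moreover have "x < 2 * pi / 3" if "x * 2 \<le> pi" for x
    using that pi_gt3 by linarith
  ultimately have "\<bar>t - of_int k * pi\<bar> < 2 * pi / 3" by blast
  then have ne: "velocity curve (t - of_int k * pi) \<noteq> 0" by (rule base)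
  show "velocity curve t \<noteq> 0"
  proof (cases "k \<ge> 0")
    case True
    then have "t = t - of_int k * pi + real (nat k) * pi" by simp
    then show ?thesis using shifts[of "t - of_int k * pi" "nat k"] ne by metis
  next
    case False
    then have "t - of_int k * pi = t + real (nat (- k)) * pi" by simp
    then show ?thesis using shifts[of t "nat (- k)"] ne by metis
  qed
qed

sublocale closed: closed_immersed_curve curve
  by unfold_locales (rule smooth_curve immersed_curve)+

text \<open>The acceleration component along the velocity is real after division and drops out of
  the imaginary part. What remains is the density in the parameter \<open>S\<close>, with a single
  factor \<open>deriv S t\<close>.\<close>

lemma bottom_energy_density:
  assumes "\<bar>t\<bar> < 2 * pi / 3"
  shows "(curvature curve t)\<^sup>2 * hyp_speed curve t
    = deriv S t * ((model_turning M (S t))\<^sup>2 / model_speed M (S t))"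
proof -
  define d s u1 u2 where defs: "d = deriv S t" "s = S t"
    "u1 = Complex (c * cutoff1 M s) (c * sinh s)" "u2 = Complex (c * cutoff2 M s) (c * cosh s)"
  have d0: "d > 0" unfolding defs using assms pi_gt_zero by (intro S_deriv_pos) linarith
  have v: "velocity curve t = of_real d * u1"
    by (simp add: bottom_velocity[OF assms] defs scaleR_conv_of_real)
  have a: "vector_derivative (velocity curve) (at t) = of_real (d\<^sup>2) * u2 + of_real (deriv (deriv S) t) * u1"
    by (simp add: bottom_acceleration[OF assms] defs scaleR_conv_of_real)
  have u1: "u1 \<noteq> 0" using closed.velocity_nonzero[of t] unfolding v by auto
  have y: "Im (curve t) = c * cosh s" by (simp add: bottom[OF assms] defs)
  have sq: "(c * cutoff1 M s)\<^sup>2 + (c * sinh s)\<^sup>2 = c\<^sup>2 * ((cutoff1 M s)\<^sup>2 + (sinh s)\<^sup>2)"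
    by (simp add: power_mult_distrib algebra_simps)
  have "norm u1 = c * sqrt ((cutoff1 M s)\<^sup>2 + (sinh s)\<^sup>2)"
    using c by (simp add: defs(3) cmod_def sq real_sqrt_mult)
  then have speed: "hyp_speed curve t = d * model_speed M s"
    unfolding closed.speed_eq v y model_speed_def using d0 c by (simp add: norm_mult)
  have "vector_derivative (velocity curve) (at t) / velocity curve t
      = of_real d * (u2 / u1) + of_real (deriv (deriv S) t / d)"
    unfolding a v using d0 u1 by (simp add: add_divide_distrib power2_eq_square)
  then have "Im (vector_derivative (velocity curve) (at t) / velocity curve t) = d * Im (u2 / u1)"
    by (simp del: times_divide_eq_right)
  moreover have "Im (u2 / u1) = (cutoff1 M s * cosh s - cutoff2 M s * sinh s) / ((cutoff1 M s)\<^sup>2 + (sinh s)\<^sup>2)"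
  proof -
    have "Im (u2 / u1) = c\<^sup>2 * (cutoff1 M s * cosh s - cutoff2 M s * sinh s)
        / (c\<^sup>2 * ((cutoff1 M s)\<^sup>2 + (sinh s)\<^sup>2))"
      unfolding sq[symmetric] by (simp add: Im_divide defs(3,4) power2_eq_square algebra_simps)
    then show ?thesis using c by simp
  qed
  moreover have "Re (velocity curve t) / Im (curve t) = d * (cutoff1 M s / cosh s)"
    unfolding v y using c by (simp add: defs(3))
  ultimately have turn: "curvature curve t * hyp_speed curve t = d * model_turning M s"
    unfolding closed.curvature_times_speed model_turning_def by (simp add: distrib_left)
  have "(curvature curve t)\<^sup>2 * hyp_speed curve t
      = (curvature curve t * hyp_speed curve t)\<^sup>2 / hyp_speed curve t"
    using closed.speed_pos[of t] by (simp add: power2_eq_square)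
  also have "\<dots> = d * ((model_turning M s)\<^sup>2 / model_speed M s)"
    unfolding turn unfolding speed using d0 by (simp add: power_mult_distrib power2_eq_square)
  finally show ?thesis by (simp add: defs)
qed

lemma curve_energy:
  assumes "\<epsilon> > 0"
    and model: "\<And>s. (model_turning M s)\<^sup>2 / model_speed M s \<le> 4 / (cosh s)\<^sup>2 + \<epsilon> / (1 + s\<^sup>2)"
  shows "elastic_energy curve \<le> 16 + 2 * pi * \<epsilon>"
proof -
  \<comment> \<open>An antiderivative of the density bound: over the half period
    \<open>4 * tanh\<close> gains at most 8 and \<open>arctan\<close> at most \<open>pi\<close>. The
    two halves give 16 and the error \<open>2 * pi * \<epsilon>\<close>.\<close>
  define F where "F t = 4 * tanh (S t) + \<epsilon> * arctan (S t)" for t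
  have "elastic_energy curve \<le> 2 * (F (pi / 2) - F (- (pi / 2)))"
  proof (rule closed.energy_le_of_half[OF curve_inversion])
    fix t assume t: "\<bar>t\<bar> \<le> pi / 2"
    have t': "\<bar>t\<bar> < 2 * pi / 3" "\<bar>t\<bar> < pi" using t pi_gt_zero by linarith+
    have ta: "(tanh has_real_derivative 1 / (cosh x)\<^sup>2) (at x)" for x :: real
    proof -
      have "(tanh has_real_derivative 1 - (tanh x)\<^sup>2) (at x)"
        by (auto intro!: derivative_eq_intros)
      moreover have "1 - (tanh x)\<^sup>2 = 1 / (cosh x)\<^sup>2"
      proof -
        have "1 - (tanh x)\<^sup>2 = ((cosh x)\<^sup>2 - (sinh x)\<^sup>2) / (cosh x)\<^sup>2"
          by (simp add: tanh_def power_divide diff_divide_distrib)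
        then show ?thesis by (simp add: cosh_square_eq)
      qed
      ultimately show ?thesis by simp
    qed
    have at: "(arctan has_real_derivative 1 / (1 + x\<^sup>2)) (at x)" for x
      using DERIV_arctan[of x] by (simp add: inverse_eq_divide)
    show "(F has_real_derivative
        4 * (1 / (cosh (S t))\<^sup>2 * deriv S t) + \<epsilon> * (1 / (1 + (S t)\<^sup>2) * deriv S t)) (at t)"
      unfolding F_def[abs_def]
      by (intro DERIV_add DERIV_cmult DERIV_chain2[OF ta S_deriv(1)] DERIV_chain2[OF at S_deriv(1)])
    have "deriv S t * ((model_turning M (S t))\<^sup>2 / model_speed M (S t))
        \<le> deriv S t * (4 / (cosh (S t))\<^sup>2 + \<epsilon> / (1 + (S t)\<^sup>2))"
      using S_deriv_pos[OF t'(2)] model by (intro mult_left_mono) auto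
    then show "(curvature curve t)\<^sup>2 * hyp_speed curve t
      \<le> 4 * (1 / (cosh (S t))\<^sup>2 * deriv S t) + \<epsilon> * (1 / (1 + (S t)\<^sup>2) * deriv S t)"
      unfolding bottom_energy_density[OF t'(1)] by (simp add: algebra_simps)
  qed
  also have "\<dots> \<le> 2 * (8 + \<epsilon> * pi)"
  proof -
    have "\<epsilon> * arctan (S (pi / 2)) \<le> \<epsilon> * (pi / 2)" "\<epsilon> * - (pi / 2) \<le> \<epsilon> * arctan (S (- (pi / 2)))"
      using assms(1) arctan_bounded[of "S (pi / 2)"] arctan_bounded[of "S (- (pi / 2))"]
      by (intro mult_left_mono; simp)+
    then show ?thesis
      using tanh_real_bounds[of "S (pi / 2)"] tanh_real_bounds[of "S (- (pi / 2))"]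
      by (simp add: F_def)
  qed
  finally show ?thesis by (simp add: algebra_simps)
qed

text \<open>The curve passes through \<open>c * \<i>\<close> at 0 and, by inversion, through
  \<open>\<i> / c\<close> at \<open>pi\<close>.\<close>

lemma curve_length: "hyp_length curve \<ge> - 2 * ln c"
proof -
  have S0: "S 0 = 0" by (simp add: S_def Q_def)
  have c0: "curve 0 = Complex 0 c"
    using bottom[of 0] by (simp add: S0 cutoff_def)
  have "curve pi * curve 0 = - 1" using curve_inversion[of 0] by simp
  then have "c * Im (curve pi) = 1" unfolding c0 by (simp add: complex_eq_iff mult.commute)
  then have "Im (curve pi) = inverse c" using c by (simp add: field_simps)
  then show ?thesis
    using closed.length_ge_ln_ratio c by (simp add: c0 ln_inverse)
qed

end

section \<open>The two infima\<close>

lemma quotient_arbitrarily_small: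
  assumes "\<delta> > 0" "r > 0"
  obtains \<gamma> where "smooth_closed_curve \<gamma>" "immersed \<gamma>" "elastic_energy \<gamma> \<le> 16 + \<delta>"
    "elastic_energy \<gamma> / hyp_length \<gamma> < r"
proof -
  \<comment> \<open>Order of choices: \<open>\<epsilon>\<close> from \<open>\<delta>\<close>, then
    \<open>M\<close> from \<open>\<epsilon>\<close>, and \<open>c\<close> last, small enough to
    satisfy \<open>far\<close> for this \<open>M\<close> and to make the length exceed
    \<open>(16 + \<delta>) / r\<close>. The energy bound does not depend on
    \<open>c\<close>.\<close>
  define \<epsilon> where "\<epsilon> = \<delta> / (2 * pi)"
  have \<epsilon>: "\<epsilon> > 0" "2 * pi * \<epsilon> = \<delta>" using assms by (simp_all add: \<epsilon>_def)
  obtain M where model: "M \<ge> 1"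
    "\<And>s. (model_turning M s)\<^sup>2 / model_speed M s \<le> 4 / (cosh s)\<^sup>2 + \<epsilon> / (1 + s\<^sup>2)"
    using model_energy_density[OF \<epsilon>(1)] by blast
  have "filterlim (\<lambda>c::real. sqrt (1 - c ^ 4) / (2 * c)) at_top (at_right 0)"
    "filterlim (\<lambda>c::real. - 2 * ln c) at_top (at_right 0)"
    by real_asymp+
  then have "\<forall>\<^sub>F c in at_right 0. sinh (M + 1) \<le> sqrt (1 - c ^ 4) / (2 * c)"
    "\<forall>\<^sub>F c in at_right 0. (16 + \<delta>) / r + 1 \<le> - 2 * ln c"
    unfolding filterlim_at_top by blast+
  moreover have "\<forall>\<^sub>F c::real in at_right 0. c < 1" "\<forall>\<^sub>F c::real in at_right 0. 0 < c"
    by (auto simp: eventually_at_right_field intro: exI[of _ 1])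
  ultimately have "\<forall>\<^sub>F c in at_right 0. sinh (M + 1) \<le> sqrt (1 - c ^ 4) / (2 * c) \<and>
      (16 + \<delta>) / r + 1 \<le> - 2 * ln c \<and> c < 1 \<and> 0 < c"
    by eventually_elim auto
  then obtain c where small: "sinh (M + 1) \<le> sqrt (1 - c ^ 4) / (2 * c)"
    "(16 + \<delta>) / r + 1 \<le> - 2 * ln c" "c < 1" "0 < c"
    using eventually_happens[of _ "at_right (0::real)"] by auto
  interpret doubled_catenary c M using small model(1) by unfold_locales
  have E: "elastic_energy curve \<le> 16 + \<delta>" using curve_energy[OF \<epsilon>(1) model(2)] \<epsilon>(2) by simp
  have "(16 + \<delta>) / r < hyp_length curve" using curve_length small(2) by linarith
  then have "16 + \<delta> < r * hyp_length curve" using assms(2) by (simp add: field_simps)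
  then have "elastic_energy curve < r * hyp_length curve" using E by linarith
  then have "elastic_energy curve / hyp_length curve < r"
    using closed.length_pos by (simp add: field_simps)
  with that smooth_curve immersed_curve E show ?thesis by blast
qed

theorem theorem1p1:
  fixes \<delta> :: real
  assumes "\<delta> > 0"
  shows "(\<exists>c::real. c > 0 \<and>
            Inf {ereal (elastic_energy \<gamma> / hyp_length \<gamma>) | \<gamma>.
                  smooth_closed_curve \<gamma> \<and> immersed \<gamma> \<and> elastic_energy \<gamma> \<le> 16 - \<delta>} \<ge> ereal c)
       \<and> Inf {ereal (elastic_energy \<gamma> / hyp_length \<gamma>) | \<gamma>.
                  smooth_closed_curve \<gamma> \<and> immersed \<gamma> \<and> elastic_energy \<gamma> \<le> 16 + \<delta>} = 0"
proof
  obtain c where c: "c > 0" "\<And>\<gamma>. smooth_closed_curve \<gamma> \<and> immersed \<gamma> \<and> elastic_energy \<gamma> \<le> 16 - \<delta>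
      \<Longrightarrow> c \<le> elastic_energy \<gamma> / hyp_length \<gamma>"
    using quotient_bounded_below[OF assms] by blast
  then show "\<exists>c::real. c > 0 \<and>
      Inf {ereal (elastic_energy \<gamma> / hyp_length \<gamma>) | \<gamma>.
        smooth_closed_curve \<gamma> \<and> immersed \<gamma> \<and> elastic_energy \<gamma> \<le> 16 - \<delta>} \<ge> ereal c"
    \<comment> \<open>For large \<open>\<delta>\<close> the set is empty and its infimum infinite;
      \<open>Inf_greatest\<close> includes this case.\<close>
    by (intro exI[of _ c] conjI Inf_greatest) auto
  let ?A = "{ereal (elastic_energy \<gamma> / hyp_length \<gamma>) | \<gamma>.
      smooth_closed_curve \<gamma> \<and> immersed \<gamma> \<and> elastic_energy \<gamma> \<le> 16 + \<delta>}"
  show "Inf ?A = 0"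
  proof (rule antisym)
    show "Inf ?A \<le> 0"
    proof (rule ereal_le_epsilon2)
      fix r :: real assume "0 < r"
      then obtain \<gamma> where \<gamma>: "smooth_closed_curve \<gamma>" "immersed \<gamma>" "elastic_energy \<gamma> \<le> 16 + \<delta>"
        "elastic_energy \<gamma> / hyp_length \<gamma> < r"
        using quotient_arbitrarily_small[OF assms] by blast
      have "Inf ?A \<le> ereal (elastic_energy \<gamma> / hyp_length \<gamma>)"
        using \<gamma> by (intro Inf_lower) auto
      also have "\<dots> \<le> ereal r" using \<gamma>(4) by simp
      finally show "Inf ?A \<le> 0 + ereal r" by simp
    qed
    show "0 \<le> Inf ?A"
    proof (rule Inf_greatest)
      fix x assume "x \<in> ?A"
      then obtain \<gamma> where \<gamma>: "x = ereal (elastic_energy \<gamma> / hyp_length \<gamma>)"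
        "smooth_closed_curve \<gamma>" "immersed \<gamma>" by blast
      interpret closed_immersed_curve \<gamma> using \<gamma> by unfold_locales
      show "0 \<le> x" using energy_ge_8 length_pos \<gamma>(1) by simp
    qed
  qed
qed


end
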